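(* Let $G$ be a locally compact group. If for some $1\le p<+\infty$, some $S\subset G$ and some $S$-admissible weight $\omega$ on $G$ there exists a $(\mathbb{C},S)$-dense vector in $L^p(G,\omega)$, then $G$ is second-countable, which is equivalent to saying that $L^p(G,\omega)$ is separable.
   Context: Let $\mu$ be a left Haar measure on $G$. A weight on $G$ is a positive measurable function $\omega:G\to(0,+\infty)$ that is locally $p$-integrable, i.e. $\int_K\omega^p\,d\mu<+\infty$ for every compact $K\subset G$. $L^p(G,\omega)$ is the space of measurable $f:G\to\mathbb{C}$ (modulo a.e. equality) with $\|f\|_{p,\omega}:=\left(\int_G|f(t)|^p\omega(t)^p\,d\mu(t)\right)^{1/p}<\infty$, with this norm. For $s\in G$, the left translation is $(T_sf)(t)=f(s^{-1}t)$. The weight $\omega$ is $S$-admissible if $M(s):=\operatorname{ess\,sup}_{t\in G}\omega(st)/\omega(t)<+\infty$ for all $s\in S$ (equivalently, $T_s$ is a bounded operator of $L^p(G,\omega)$ into itself for every $s\in S$). A vector $f\in L^p(G,\omega)$ is $(\mathbb{C},S)$-dense if $\{\lambda T_sf:\ \lambda\in\mathbb{C},\ s\in S\}$ is dense in $L^p(G,\omega)$. *)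

theory Defs
  imports "HOL-Probability.Essential_Supremum"
begin

text \<open>
  Groups are written additively, following the class \<^class>\<open>topological_group_add\<close>; it is based on
  \<^class>\<open>group_add\<close>, so commutativity is not assumed. Thus \<open>s + t\<close> stands for the product \<open>s t\<close>
  and \<open>- s + t\<close> for \<open>s\<^sup>-\<^sup>1 t\<close>.

  A left Haar measure is a nonzero left-invariant Radon measure on the Borel sets: finite on
  compact sets, outer regular on Borel sets, inner regular on open sets.
\<close>

definition left_haar_measure :: "'a::topological_group_add measure \<Rightarrow> bool" where
  "left_haar_measure M \<longleftrightarrow>
     sets M = sets borel \<and>
     emeasure M UNIV \<noteq> 0 \<and>
     (\<forall>s. \<forall>A\<in>sets borel. emeasure M ((+) s ` A) = emeasure M A) \<and>
     (\<forall>K. compact K \<longrightarrow> emeasure M K < \<infinity>) \<and>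
     (\<forall>A\<in>sets borel. emeasure M A = (INF U\<in>{U. open U \<and> A \<subseteq> U}. emeasure M U)) \<and>
     (\<forall>U. open U \<longrightarrow> emeasure M U = (SUP K\<in>{K. compact K \<and> K \<subseteq> U}. emeasure M K))"

definition weight :: "'a::topological_group_add measure \<Rightarrow> real \<Rightarrow> ('a \<Rightarrow> real) \<Rightarrow> bool" where
  "weight M p \<omega> \<longleftrightarrow>
     \<omega> \<in> borel_measurable M \<and> (\<forall>t. 0 < \<omega> t) \<and>
     (\<forall>K. compact K \<longrightarrow> (\<integral>\<^sup>+t\<in>K. ennreal (\<omega> t powr p) \<partial>M) < \<infinity>)"

definition admissible :: "'a::topological_group_add measure \<Rightarrow> 'a set \<Rightarrow> ('a \<Rightarrow> real) \<Rightarrow> bool" where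
  "admissible M S \<omega> \<longleftrightarrow> (\<forall>s\<in>S. esssup M (\<lambda>t. ennreal (\<omega> (s + t) / \<omega> t)) < \<infinity>)"

definition Lp_integral :: "'a measure \<Rightarrow> real \<Rightarrow> ('a \<Rightarrow> real) \<Rightarrow> ('a \<Rightarrow> complex) \<Rightarrow> ennreal" where
  "Lp_integral M p \<omega> f = (\<integral>\<^sup>+t. ennreal (cmod (f t) powr p * \<omega> t powr p) \<partial>M)"

definition Lp_norm :: "'a measure \<Rightarrow> real \<Rightarrow> ('a \<Rightarrow> real) \<Rightarrow> ('a \<Rightarrow> complex) \<Rightarrow> real" where
  "Lp_norm M p \<omega> f = enn2real (Lp_integral M p \<omega> f) powr (1 / p)"

definition Lp_functions :: "'a measure \<Rightarrow> real \<Rightarrow> ('a \<Rightarrow> real) \<Rightarrow> ('a \<Rightarrow> complex) set" where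
  "Lp_functions M p \<omega> = {f \<in> borel_measurable M. Lp_integral M p \<omega> f < \<infinity>}"

definition Lp_eq ::
    "'a measure \<Rightarrow> real \<Rightarrow> ('a \<Rightarrow> real) \<Rightarrow> (('a \<Rightarrow> complex) \<times> ('a \<Rightarrow> complex)) set" where
  "Lp_eq M p \<omega> =
     {(f, g). f \<in> Lp_functions M p \<omega> \<and> g \<in> Lp_functions M p \<omega> \<and> (AE t in M. f t = g t)}"

definition Lp_space :: "'a measure \<Rightarrow> real \<Rightarrow> ('a \<Rightarrow> real) \<Rightarrow> ('a \<Rightarrow> complex) set set" where
  "Lp_space M p \<omega> = Lp_functions M p \<omega> // Lp_eq M p \<omega>"

definition Lp_class ::
    "'a measure \<Rightarrow> real \<Rightarrow> ('a \<Rightarrow> real) \<Rightarrow> ('a \<Rightarrow> complex) \<Rightarrow> ('a \<Rightarrow> complex) set" where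
  "Lp_class M p \<omega> f = Lp_eq M p \<omega> `` {f}"

text \<open>The distance does not depend on the representatives chosen by \<open>SOME\<close>.\<close>

definition Lp_dist ::
    "'a measure \<Rightarrow> real \<Rightarrow> ('a \<Rightarrow> real) \<Rightarrow> ('a \<Rightarrow> complex) set \<Rightarrow> ('a \<Rightarrow> complex) set \<Rightarrow> real" where
  "Lp_dist M p \<omega> F G = Lp_norm M p \<omega> (\<lambda>t. (SOME f. f \<in> F) t - (SOME g. g \<in> G) t)"

definition Lp_topology ::
    "'a measure \<Rightarrow> real \<Rightarrow> ('a \<Rightarrow> real) \<Rightarrow> ('a \<Rightarrow> complex) set topology" where
  "Lp_topology M p \<omega> = Metric_space.mtopology (Lp_space M p \<omega>) (Lp_dist M p \<omega>)"

definition translate :: "'a::group_add \<Rightarrow> ('a \<Rightarrow> complex) \<Rightarrow> 'a \<Rightarrow> complex" where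
  "translate s f = (\<lambda>t. f (- s + t))"

text \<open>A vector of the space is given by a function \<open>f\<close> representing it.\<close>

definition dense_vector ::
    "'a::topological_group_add measure \<Rightarrow> real \<Rightarrow> ('a \<Rightarrow> real) \<Rightarrow> 'a set \<Rightarrow> ('a \<Rightarrow> complex) \<Rightarrow> bool" where
  "dense_vector M p \<omega> S f \<longleftrightarrow>
     f \<in> Lp_functions M p \<omega> \<and>
     Lp_topology M p \<omega> closure_of
       {Lp_class M p \<omega> (\<lambda>t. c * translate s f t) | c s. s \<in> S} = Lp_space M p \<omega>"

end

theory Submission
  imports Defs
begin

text \<open>
  Fix a compact neighbourhood \<open>K\<close> of \<open>0\<close>. If countably many Borel sets approximate all compact
  \<open>A \<subseteq> K\<close> in the measure of the symmetric difference inside \<open>K\<close>, then \<open>G\<close> is first countable, because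
  \<open>x \<mapsto> \<mu> ((x + D) \<triangle> D)\<close> is continuous at \<open>0\<close> for compact \<open>D\<close>; if moreover countably many translates
  of any neighbourhood of \<open>0\<close> cover \<open>G\<close>, then \<open>G\<close> is second countable. For separable \<open>L\<^sup>p\<close>, the sets
  \<open>{\<bar>d - 1\<bar> < 1/2}\<close> with \<open>d\<close> in a countable dense set provide the approximation, and approximating
  the indicators of the translates of an open set gives the cover.

  For a dense vector \<open>f\<close>, density forces \<open>G\<close> to be \<open>\<sigma>\<close>-compact. Approximants of \<open>A\<close> are the sets
  \<open>s + {\<bar>c f - 1\<bar> < 1/2}\<close>, where \<open>c\<close> may be taken from a countable set; replacing
  \<open>{\<bar>c f - 1\<bar> < 1/2}\<close> by compact subsets \<open>C\<close>, the continuity of \<open>s \<mapsto> s + C\<close> and \<open>\<sigma>\<close>-compactness reduce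
  \<open>s\<close> to a countable set as well.
\<close>

section \<open>Minkowski's inequality for the weighted norm\<close>

text \<open>Convexity of the power function is applied to positive reals; when \<open>a\<close> or
  \<open>b\<close> is zero, the claim follows from \<open>k powr p \<le> k\<close> for
  \<open>k\<close> strictly between 0 and 1.\<close>

lemma powr_convex_combination:
  fixes a b l p :: real
  assumes "1 \<le> p" "0 < l" "l < 1" "0 \<le> a" "0 \<le> b"
  shows "(l * a + (1 - l) * b) powr p \<le> l * a powr p + (1 - l) * b powr p"
proof -
  have shrink: "(k * c) powr p \<le> k * c powr p" if "0 < k" "k < 1" "0 \<le> c" for k c :: real
  proof -
    have "k powr p \<le> k powr 1"
      using that \<open>1 \<le> p\<close> by (intro powr_mono') auto
    then show ?thesis
      using that by (auto simp: powr_mult intro!: mult_right_mono)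
  qed
  consider "a = 0" | "b = 0" | "0 < a" "0 < b"
    using assms by linarith
  then show ?thesis
  proof cases
    case 1
    then show ?thesis using shrink[of "1 - l" b] assms by simp
  next
    case 2
    then show ?thesis using shrink[of l a] assms by simp
  next
    case 3
    then show ?thesis
      using convex_onD[OF powr_convex[OF \<open>1 \<le> p\<close>], of "1 - l" a b] assms by simp
  qed
qed

locale weighted_Lp =
  fixes M :: "'a measure" and p :: real and \<omega> :: "'a \<Rightarrow> real"
  assumes p_ge_1: "1 \<le> p"
    and weight_measurable [measurable]: "\<omega> \<in> borel_measurable M"
    and weight_pos: "\<And>t. 0 < \<omega> t"
begin

abbreviation L :: "('a \<Rightarrow> complex) set" where "L \<equiv> Lp_functions M p \<omega>"
abbreviation I :: "('a \<Rightarrow> complex) \<Rightarrow> ennreal" where "I \<equiv> Lp_integral M p \<omega>"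
abbreviation N :: "('a \<Rightarrow> complex) \<Rightarrow> real" where "N \<equiv> Lp_norm M p \<omega>"

lemma L_measurable [measurable_dest]: "f \<in> L \<Longrightarrow> f \<in> borel_measurable M"
  by (simp add: Lp_functions_def)

lemma L_iff: "f \<in> L \<longleftrightarrow> f \<in> borel_measurable M \<and> I f < \<infinity>"
  by (simp add: Lp_functions_def)

lemma I_cong: "(AE t in M. cmod (f t) = cmod (g t)) \<Longrightarrow> I f = I g"
  unfolding Lp_integral_def by (intro nn_integral_cong_AE) auto

lemma N_cong: "(AE t in M. cmod (f t) = cmod (g t)) \<Longrightarrow> N f = N g"
  unfolding Lp_norm_def by (simp add: I_cong)

lemma N_nonneg [simp]: "0 \<le> N f"
  by (simp add: Lp_norm_def)

text \<open>Membership in \<open>L\<close> matters: \<open>enn2real\<close> sends an infinite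
  integral to 0, so outside \<open>L\<close> the value \<open>N f\<close> can vanish without
  \<open>f\<close> doing so.\<close>

lemma I_eq_N: "f \<in> L \<Longrightarrow> I f = ennreal (N f powr p)"
  using p_ge_1 by (auto simp: L_iff Lp_norm_def powr_powr less_top)

lemma N_less_iff: 
  assumes "f \<in> L" "0 < r" shows "N f < r \<longleftrightarrow> I f < ennreal (r powr p)"
proof -
  have "N f < r \<longleftrightarrow> N f powr p < r powr p"
    using assms p_ge_1 powr_less_mono2[of p "N f" r] powr_mono2[of p r "N f"] by force
  then show ?thesis using assms by (simp add: I_eq_N ennreal_less_iff)
qed

lemma N_minus_commute: "N (\<lambda>t. f t - g t) = N (\<lambda>t. g t - f t)"
  by (intro N_cong) (simp add: norm_minus_commute)

lemma I_mono:
  assumes "AE t in M. cmod (f t) \<le> cmod (g t)"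
  shows "I f \<le> I g"
  unfolding Lp_integral_def
  using assms p_ge_1
  by (intro nn_integral_mono_AE) (auto intro!: ennreal_leI mult_right_mono powr_mono2)

lemma L_bounded:
  assumes "g \<in> L" "f \<in> borel_measurable M" "AE t in M. cmod (f t) \<le> cmod (g t)"
  shows "f \<in> L"
  using I_mono[OF assms(3)] assms(1,2) by (auto simp: L_iff)

lemma I_scale:
  assumes [measurable]: "f \<in> borel_measurable M"
  shows "I (\<lambda>t. c * f t) = ennreal (cmod c powr p) * I f"
  unfolding Lp_integral_def
  by (subst nn_integral_cmult[symmetric])
     (auto simp: norm_mult powr_mult ennreal_mult' mult.assoc intro!: nn_integral_cong)

lemma L_scale: "f \<in> L \<Longrightarrow> (\<lambda>t. c * f t) \<in> L"
  by (auto simp: L_iff I_scale ennreal_mult_less_top)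

lemma N_scale: "f \<in> L \<Longrightarrow> N (\<lambda>t. c * f t) = cmod c * N f"
  using p_ge_1 by (auto simp: Lp_norm_def I_scale L_measurable enn2real_mult powr_mult powr_powr)

lemma I_eq_0: "f \<in> L \<Longrightarrow> I f = 0 \<longleftrightarrow> (AE t in M. f t = 0)"
  unfolding Lp_integral_def
  by (subst nn_integral_0_iff_AE)
     (auto simp: L_measurable weight_pos less_imp_neq[OF weight_pos, symmetric]
       ennreal_eq_0_iff mult_le_0_iff powr_nonneg_iff not_le)

lemma N_eq_0: "f \<in> L \<Longrightarrow> N f = 0 \<longleftrightarrow> (AE t in M. f t = 0)"
  using I_eq_0[of f] by (auto simp: I_eq_N)

text \<open>The sum \<open>cmod (f t) + cmod (g t)\<close> is \<open>N f + N g\<close> times a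
  convex combination of \<open>cmod (f t) / N f\<close> and \<open>cmod (g t) / N g\<close>.
  Convexity of the \<open>p\<close>-th power bounds it pointwise, and integrating this bound gives
  the result without Hoelder's inequality.\<close>

lemma minkowski_aux:
  assumes f: "f \<in> L" and g: "g \<in> L" and pos: "0 < N f" "0 < N g"
  shows "I (\<lambda>t. f t + g t) \<le> ennreal ((N f + N g) powr p)"
proof -
  let ?a = "N f" and ?b = "N g"
  define l where "l = ?a / (?a + ?b)"
  have l: "0 < l" "l < 1" using pos by (auto simp: l_def field_simps)
  have [measurable]: "f \<in> borel_measurable M" "g \<in> borel_measurable M"
    using f g by (auto simp: L_iff)
  \<comment> \<open>With these constants \<open>k * N f powr p + m * N g powr p\<close> equals
    \<open>(N f + N g) powr p\<close>, since the weights \<open>l\<close> and \<open>1 - l\<close>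
    add up to 1.\<close>
  define k where "k = (?a + ?b) powr p * (l / ?a powr p)"
  define m where "m = (?a + ?b) powr p * ((1 - l) / ?b powr p)"
  have km: "0 \<le> k" "0 \<le> m" using l by (auto simp: k_def m_def)
  have pw: "cmod (f t + g t) powr p \<le> k * cmod (f t) powr p + m * cmod (g t) powr p" for t
  proof -
    have "l / ?a = 1 / (?a + ?b)" "(1 - l) / ?b = 1 / (?a + ?b)"
      using pos by (auto simp: l_def divide_simps)
    then have "l / ?a * cmod (f t) + (1 - l) / ?b * cmod (g t) = (cmod (f t) + cmod (g t)) / (?a + ?b)"
      by (simp add: add_divide_distrib)
    then have eq: "cmod (f t) + cmod (g t) = (?a + ?b) * (l * (cmod (f t) / ?a) + (1 - l) * (cmod (g t) / ?b))"
      using pos by (simp add: field_simps)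
    have "cmod (f t + g t) powr p \<le> (cmod (f t) + cmod (g t)) powr p"
      using p_ge_1 by (intro powr_mono2) (auto simp: norm_triangle_ineq)
    also have "\<dots> = (?a + ?b) powr p * (l * (cmod (f t) / ?a) + (1 - l) * (cmod (g t) / ?b)) powr p"
      unfolding eq by (rule powr_mult)
    also have "\<dots> \<le> (?a + ?b) powr p * (l * (cmod (f t) / ?a) powr p + (1 - l) * (cmod (g t) / ?b) powr p)"
      using l pos p_ge_1 by (intro mult_left_mono powr_convex_combination) auto
    also have "\<dots> = k * cmod (f t) powr p + m * cmod (g t) powr p"
      using pos by (simp add: powr_divide k_def m_def distrib_left)
    finally show ?thesis .
  qed
  have "I (\<lambda>t. f t + g t) \<le> (\<integral>\<^sup>+t. ennreal k * ennreal (cmod (f t) powr p * \<omega> t powr p)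
      + ennreal m * ennreal (cmod (g t) powr p * \<omega> t powr p) \<partial>M)"
    unfolding Lp_integral_def
  proof (intro nn_integral_mono)
    fix t
    have "cmod (f t + g t) powr p * \<omega> t powr p \<le> k * (cmod (f t) powr p * \<omega> t powr p) + m * (cmod (g t) powr p * \<omega> t powr p)"
      using mult_right_mono[OF pw[of t], of "\<omega> t powr p"] by (simp add: algebra_simps)
    then show "ennreal (cmod (f t + g t) powr p * \<omega> t powr p) \<le> ennreal k * ennreal (cmod (f t) powr p * \<omega> t powr p)
      + ennreal m * ennreal (cmod (g t) powr p * \<omega> t powr p)"
      using km by (simp add: ennreal_mult[symmetric] ennreal_plus[symmetric] ennreal_leI del: ennreal_plus)
  qed
  also have "\<dots> = ennreal k * I f + ennreal m * I g"
    unfolding Lp_integral_def by (simp add: nn_integral_add nn_integral_cmult)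
  also have "\<dots> = ennreal (k * N f powr p + m * N g powr p)"
    using km by (simp add: I_eq_N[OF f] I_eq_N[OF g] ennreal_mult)
  also have "k * N f powr p + m * N g powr p = (N f + N g) powr p"
    using pos by (simp add: k_def m_def distrib_left[symmetric])
  finally show ?thesis .
qed

lemma minkowski:
  assumes f: "f \<in> L" and g: "g \<in> L"
  shows "(\<lambda>t. f t + g t) \<in> L" "N (\<lambda>t. f t + g t) \<le> N f + N g"
proof -
  have [measurable]: "f \<in> borel_measurable M" "g \<in> borel_measurable M"
    using f g by (auto simp: L_iff)
  have *: "I (\<lambda>t. f t + g t) \<le> ennreal ((N f + N g) powr p)"
  proof -
    consider "N f = 0" | "N g = 0" | "0 < N f" "0 < N g"
      by (metis N_nonneg less_eq_real_def)
    then show ?thesis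
    proof cases
      case 1
      then have "I (\<lambda>t. f t + g t) = I g" using f by (intro I_cong) (auto simp: N_eq_0)
      then show ?thesis by (simp add: 1 I_eq_N g)
    next
      case 2
      then have "I (\<lambda>t. f t + g t) = I f" using g by (intro I_cong) (auto simp: N_eq_0)
      then show ?thesis by (simp add: 2 I_eq_N f)
    next
      case 3
      then show ?thesis by (rule minkowski_aux[OF f g])
    qed
  qed
  \<comment> \<open>The bound is finite, so the sum lies in \<open>L\<close>; only then may
    \<open>I_eq_N\<close> turn the bound on \<open>I\<close> into one on \<open>N\<close>.\<close>
  then show L: "(\<lambda>t. f t + g t) \<in> L"
    by (auto simp: L_iff intro: le_less_trans)
  show "N (\<lambda>t. f t + g t) \<le> N f + N g"
  proof (rule ccontr)
    assume "\<not> ?thesis"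
    then have "(N f + N g) powr p < N (\<lambda>t. f t + g t) powr p"
      using p_ge_1 by (intro powr_less_mono2) auto
    then show False using * by (simp add: I_eq_N[OF L] ennreal_le_iff)
  qed
qed

lemma L_diff: 
  assumes "f \<in> L" "g \<in> L" shows "(\<lambda>t. f t - g t) \<in> L"
  using minkowski(1)[OF assms(1) L_scale[OF assms(2), of "-1"]] by simp

lemma N_triangle:
  assumes "f \<in> L" "g \<in> L" "h \<in> L"
  shows "N (\<lambda>t. f t - h t) \<le> N (\<lambda>t. f t - g t) + N (\<lambda>t. g t - h t)"
  using minkowski(2)[OF L_diff[OF assms(1,2)] L_diff[OF assms(2,3)]] by simp

section \<open>The metric space of classes and its dense sets\<close>

lemma Lp_eq_equiv: "equiv L (Lp_eq M p \<omega>)"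
  by (rule equivI) (auto simp: refl_on_def sym_def trans_def Lp_eq_def)

lemma class_in_space: "f \<in> L \<Longrightarrow> Lp_class M p \<omega> f \<in> Lp_space M p \<omega>"
  unfolding Lp_class_def Lp_space_def by (rule quotientI)

text \<open>A function outside \<open>L\<close> is related to nothing, so its class is empty, and no
  member of a quotient is empty.\<close>

lemma class_in_space_iff: "Lp_class M p \<omega> f \<in> Lp_space M p \<omega> \<longleftrightarrow> f \<in> L"
proof
  assume "Lp_class M p \<omega> f \<in> Lp_space M p \<omega>"
  then have "Lp_class M p \<omega> f \<noteq> {}"
    unfolding Lp_space_def using in_quotient_imp_non_empty[OF Lp_eq_equiv] by metis
  then show "f \<in> L" by (auto simp: Lp_class_def Lp_eq_def)
qed (rule class_in_space)

lemma space_cases: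
  assumes "F \<in> Lp_space M p \<omega>"
  obtains f where "f \<in> L" "F = Lp_class M p \<omega> f"
  using assms unfolding Lp_space_def Lp_class_def by (auto elim: quotientE)

lemma some_in_class:
  assumes "f \<in> L"
  shows "(SOME g. g \<in> Lp_class M p \<omega> f) \<in> L" "AE t in M. (SOME g. g \<in> Lp_class M p \<omega> f) t = f t"
proof -
  have "f \<in> Lp_class M p \<omega> f" using assms by (auto simp: Lp_class_def Lp_eq_def)
  then have "(SOME g. g \<in> Lp_class M p \<omega> f) \<in> Lp_class M p \<omega> f"
    by (rule someI[of "\<lambda>g. g \<in> Lp_class M p \<omega> f"])
  then show "(SOME g. g \<in> Lp_class M p \<omega> f) \<in> L" "AE t in M. (SOME g. g \<in> Lp_class M p \<omega> f) t = f t"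
    by (auto simp: Lp_class_def Lp_eq_def elim!: eventually_mono)
qed

lemma dist_class:
  assumes "f \<in> L" "g \<in> L"
  shows "Lp_dist M p \<omega> (Lp_class M p \<omega> f) (Lp_class M p \<omega> g) = N (\<lambda>t. f t - g t)"
  unfolding Lp_dist_def
  using some_in_class(2)[OF assms(1)] some_in_class(2)[OF assms(2)] by (intro N_cong) auto

lemma class_eq_iff:
  assumes "f \<in> L" "g \<in> L"
  shows "Lp_class M p \<omega> f = Lp_class M p \<omega> g \<longleftrightarrow> (AE t in M. f t = g t)"
  unfolding Lp_class_def using eq_equiv_class_iff[OF Lp_eq_equiv assms] assms by (simp add: Lp_eq_def)

sublocale Lp: Metric_space "Lp_space M p \<omega>" "Lp_dist M p \<omega>"
proof
  show "0 \<le> Lp_dist M p \<omega> F G" for F G by (simp add: Lp_dist_def)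
  show "Lp_dist M p \<omega> F G = Lp_dist M p \<omega> G F" for F G
    unfolding Lp_dist_def by (rule N_minus_commute)
  show "Lp_dist M p \<omega> F G = 0 \<longleftrightarrow> F = G" if "F \<in> Lp_space M p \<omega>" "G \<in> Lp_space M p \<omega>" for F G
    using that
    by (elim space_cases) (simp add: dist_class class_eq_iff N_eq_0 L_diff)
  show "Lp_dist M p \<omega> F H \<le> Lp_dist M p \<omega> F G + Lp_dist M p \<omega> G H"
    if "F \<in> Lp_space M p \<omega>" "G \<in> Lp_space M p \<omega>" "H \<in> Lp_space M p \<omega>" for F G H
    using that by (elim space_cases) (simp add: dist_class N_triangle)
qed

text \<open>Transfers density from classes to functions. The set \<open>D\<close> may leave
  \<open>L\<close>: its members outside \<open>L\<close> have the empty class, which is no point of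
  the space and lies in no ball. Hence the approximants come from
  \<open>D \<inter> L\<close>.\<close>

lemma closure_of_classes:
  "Lp_topology M p \<omega> closure_of (Lp_class M p \<omega> ` D) = Lp_space M p \<omega> \<longleftrightarrow>
   (\<forall>f\<in>L. \<forall>e>0. \<exists>d\<in>D \<inter> L. N (\<lambda>t. f t - d t) < e)" (is "?lhs \<longleftrightarrow> ?rhs")
proof
  assume ?lhs
  then have *: "Lp_space M p \<omega> = {F \<in> Lp_space M p \<omega>. \<forall>r>0. \<exists>G\<in>Lp_class M p \<omega> ` D. G \<in> Lp.mball F r}"
    unfolding Lp_topology_def Lp.metric_closure_of by simp
  show ?rhs
  proof (intro ballI allI impI)
    fix f and e :: real assume f: "f \<in> L" and e: "0 < e"
    with * have "\<exists>G\<in>Lp_class M p \<omega> ` D. G \<in> Lp.mball (Lp_class M p \<omega> f) e"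
      using class_in_space[OF f] by blast
    then obtain d where d: "d \<in> D" "Lp_class M p \<omega> d \<in> Lp.mball (Lp_class M p \<omega> f) e"
      by blast
    then have "d \<in> L" by (simp add: class_in_space_iff)
    then show "\<exists>d\<in>D \<inter> L. N (\<lambda>t. f t - d t) < e"
      using d f by (intro bexI[of _ d]) (auto simp: dist_class)
  qed
next
  assume R: ?rhs
  have "\<exists>G\<in>Lp_class M p \<omega> ` D. G \<in> Lp.mball F r" if F: "F \<in> Lp_space M p \<omega>" and r: "0 < r" for F and r :: real
  proof -
    obtain f where f: "f \<in> L" "F = Lp_class M p \<omega> f" using space_cases[OF F] .
    obtain d where "d \<in> D" "d \<in> L" "N (\<lambda>t. f t - d t) < r" using R f r by blast
    then show ?thesis using f by (auto simp: dist_class class_in_space intro!: bexI[of _ d])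
  qed
  then show ?lhs unfolding Lp_topology_def Lp.metric_closure_of by blast
qed

lemma separable_iff:
  "separable_space (Lp_topology M p \<omega>) \<longleftrightarrow>
   (\<exists>D\<subseteq>L. countable D \<and> (\<forall>f\<in>L. \<forall>e>0. \<exists>d\<in>D. N (\<lambda>t. f t - d t) < e))" (is "?lhs \<longleftrightarrow> ?rhs")
proof
  assume ?lhs
  then obtain C where C: "countable C" "C \<subseteq> Lp_space M p \<omega>" "Lp_topology M p \<omega> closure_of C = Lp_space M p \<omega>"
    unfolding separable_space_def by (auto simp: Lp_topology_def)
  obtain D where D: "D \<subseteq> L" "C = Lp_class M p \<omega> ` D" "countable D"
  proof
    let ?r = "\<lambda>F. SOME f. f \<in> L \<and> F = Lp_class M p \<omega> f"
    have r: "?r F \<in> L \<and> F = Lp_class M p \<omega> (?r F)" if "F \<in> C" for F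
    proof -
      have "\<exists>f. f \<in> L \<and> F = Lp_class M p \<omega> f"
        using that C(2) by (meson space_cases subsetD)
      then show ?thesis by (rule someI_ex)
    qed
    show "?r ` C \<subseteq> L" using r by blast
    show "C = Lp_class M p \<omega> ` ?r ` C" using r by (force simp: image_image)
    show "countable (?r ` C)" using C(1) by blast
  qed
  with C(3) closure_of_classes[of D] show ?rhs
    by (intro exI[of _ D]) (auto simp: Int_absorb2)
next
  assume ?rhs
  then obtain D where D: "D \<subseteq> L" "countable D" "\<forall>f\<in>L. \<forall>e>0. \<exists>d\<in>D. N (\<lambda>t. f t - d t) < e"
    by blast
  then have "Lp_topology M p \<omega> closure_of (Lp_class M p \<omega> ` D) = Lp_space M p \<omega>"
    by (subst closure_of_classes) (simp add: Int_absorb2)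
  moreover have "Lp_class M p \<omega> ` D \<subseteq> Lp_space M p \<omega>" using D(1) class_in_space by blast
  ultimately show ?lhs
    unfolding separable_space_def using D(2)
    by (intro exI[of _ "Lp_class M p \<omega> ` D"]) (auto simp: Lp_topology_def)
qed

section \<open>Dominated convergence and smallness in measure\<close>

text \<open>The dominated convergence theorem applies to
  \<open>cmod (f t - F n t) powr p * \<omega> t powr p\<close>: both \<open>f\<close> and
  \<open>F n\<close> are bounded by \<open>h\<close> almost everywhere, so \<open>2 * h\<close>
  provides the majorant.\<close>

lemma N_dominated_convergence:
  assumes h: "h \<in> L" and [measurable]: "f \<in> borel_measurable M" "\<And>n. F n \<in> borel_measurable M"
    and bound: "\<And>n. AE t in M. cmod (F n t) \<le> cmod (h t)"
    and lim: "AE t in M. (\<lambda>n. F n t) \<longlonglongrightarrow> f t"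
    and e: "0 < e"
  shows "f \<in> L" "\<And>n. F n \<in> L" "\<exists>n. N (\<lambda>t. f t - F n t) < e"
proof -
  have [measurable]: "h \<in> borel_measurable M" using h by (rule L_measurable)
  show FL: "F n \<in> L" for n
    using L_bounded[OF h _ bound] by simp
  have "AE t in M. \<forall>n. cmod (F n t) \<le> cmod (h t)" using bound by (simp add: AE_all_countable)
  then have fh: "AE t in M. cmod (f t) \<le> cmod (h t)"
    using lim by eventually_elim (rule LIMSEQ_le_const2[OF tendsto_norm], auto)
  then show fL: "f \<in> L"
    by (intro L_bounded[OF h]) simp_all
  have diff_h: "AE t in M. cmod (f t - F n t) \<le> cmod (2 * h t)" for n
    using fh bound[of n] by eventually_elim (rule order_trans[OF norm_triangle_ineq4], simp add: norm_mult)
  have "(\<lambda>n. I (\<lambda>t. f t - F n t)) \<longlonglongrightarrow> (\<integral>\<^sup>+t. 0 \<partial>M)"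
    unfolding Lp_integral_def
  proof (rule nn_integral_dominated_convergence)
    show "AE t in M. ennreal (cmod (f t - F n t) powr p * \<omega> t powr p) \<le> ennreal (cmod (2 * h t) powr p * \<omega> t powr p)" for n
      using diff_h[of n] by eventually_elim (use p_ge_1 in \<open>auto intro!: ennreal_leI mult_right_mono powr_mono2\<close>)
    show "(\<integral>\<^sup>+t. ennreal (cmod (2 * h t) powr p * \<omega> t powr p) \<partial>M) < \<infinity>"
      using L_scale[OF h, of 2] by (simp add: L_iff Lp_integral_def)
    show "AE t in M. (\<lambda>n. ennreal (cmod (f t - F n t) powr p * \<omega> t powr p)) \<longlonglongrightarrow> 0"
      using lim
    proof eventually_elim
      case (elim t)
      then have "(\<lambda>n. cmod (f t - F n t)) \<longlonglongrightarrow> 0"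
        using tendsto_norm[OF tendsto_diff[OF tendsto_const elim, of "f t"]] by simp
      then have "(\<lambda>n. cmod (f t - F n t) powr p) \<longlonglongrightarrow> 0"
        using tendsto_powr'[of "\<lambda>n. cmod (f t - F n t)" 0 sequentially "\<lambda>_. p" p] p_ge_1 by auto
      then have "(\<lambda>n. cmod (f t - F n t) powr p * \<omega> t powr p) \<longlonglongrightarrow> 0"
        by (rule tendsto_mult_left_zero)
      then show ?case using tendsto_ennrealI by fastforce
    qed
  qed measurable
  then have "eventually (\<lambda>n. I (\<lambda>t. f t - F n t) < ennreal (e powr p)) sequentially"
    using e by (intro order_tendstoD(2)) auto
  then obtain n where "I (\<lambda>t. f t - F n t) < ennreal (e powr p)"
    by (auto simp: eventually_sequentially)
  then show "\<exists>n. N (\<lambda>t. f t - F n t) < e"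
    using N_less_iff[OF L_diff[OF fL FL] e] by blast
qed

lemma N_mono:
  assumes "AE t in M. cmod (f t) \<le> cmod (g t)" "g \<in> L"
  shows "N f \<le> N g"
  unfolding Lp_norm_def
  using I_mono[OF assms(1)] assms(2) p_ge_1
  by (intro powr_mono2 enn2real_mono) (auto simp: L_iff)

text \<open>Chebyshev's inequality for the \<open>p\<close>-th power. The weight stays inside the
  level set, as no positive lower bound for \<open>\<omega>\<close> is assumed.\<close>

lemma markov:
  assumes h: "h \<in> L" and "0 < a"
  shows "emeasure M {t \<in> space M. a \<le> cmod (h t) * \<omega> t} \<le> ennreal ((N h / a) powr p)"
proof -
  have [measurable]: "h \<in> borel_measurable M" using h by (rule L_measurable)
  have "{t \<in> space M. a \<le> cmod (h t) * \<omega> t} \<subseteq>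
    {t \<in> space M. 1 \<le> ennreal (1 / a powr p) * ennreal (cmod (h t) powr p * \<omega> t powr p)}"
  proof safe
    fix t assume "a \<le> cmod (h t) * \<omega> t"
    then have "a powr p \<le> cmod (h t) powr p * \<omega> t powr p"
      using \<open>0 < a\<close> p_ge_1 by (auto simp: powr_mult[symmetric] intro!: powr_mono2)
    then have "1 \<le> ennreal (1 / a powr p * (cmod (h t) powr p * \<omega> t powr p))"
      using \<open>0 < a\<close> by simp
    then show "1 \<le> ennreal (1 / a powr p) * ennreal (cmod (h t) powr p * \<omega> t powr p)"
      by (subst ennreal_mult'[symmetric]) auto
  qed
  then have "emeasure M {t \<in> space M. a \<le> cmod (h t) * \<omega> t} \<le> emeasure M
    {t \<in> space M. 1 \<le> ennreal (1 / a powr p) * ennreal (cmod (h t) powr p * \<omega> t powr p)}"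
    by (intro emeasure_mono) measurable
  also have "\<dots> \<le> ennreal (1 / a powr p) * (\<integral>\<^sup>+t. ennreal (cmod (h t) powr p * \<omega> t powr p) * indicator (space M) t \<partial>M)"
    by (rule nn_integral_Markov_inequality) measurable
  also have "\<dots> = ennreal (1 / a powr p) * I h"
    unfolding Lp_integral_def by (intro arg_cong2[where f="(*)"] refl nn_integral_cong) simp
  also have "\<dots> = ennreal ((N h / a) powr p)"
    using \<open>0 < a\<close> by (simp add: I_eq_N[OF h] ennreal_mult'[symmetric] powr_divide)
  finally show ?thesis .
qed

lemma level_set_fmeasurable:
  assumes K: "K \<in> fmeasurable M" and h: "h \<in> borel_measurable M"
  shows "{t \<in> K. a \<le> cmod (h t)} \<in> fmeasurable M"
proof (rule fmeasurableI2[OF K])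
  have "{t \<in> K. a \<le> cmod (h t)} = K \<inter> {t \<in> space M. a \<le> cmod (h t)}"
    using sets.sets_into_space[OF fmeasurableD[OF K]] by auto
  then show "{t \<in> K. a \<le> cmod (h t)} \<in> sets M" using K h by simp
qed auto

text \<open>The weight being positive, \<open>\<omega>\<close> is bounded below off a subset of \<open>K\<close> of small measure.\<close>

lemma small_norm_imp_small_measure:
  assumes K: "K \<in> fmeasurable M" and "0 < a" "0 < e"
  obtains \<delta> where "0 < \<delta>" "\<forall>h\<in>L. N h < \<delta> \<longrightarrow> measure M {t \<in> K. a \<le> cmod (h t)} < e"
proof -
  have [measurable]: "K \<in> sets M" using K by auto
  \<comment> \<open>These sets decrease to the empty set because \<open>\<omega>\<close> is
    positive; as \<open>K\<close> has finite measure, their measures tend to 0.\<close>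
  define E where "E n = {t \<in> K. \<omega> t \<le> 1 / real (Suc n)}" for n
  have [measurable]: "E n \<in> sets M" for n
  proof -
    have "E n = K \<inter> {t \<in> space M. \<omega> t \<le> 1 / real (Suc n)}"
      using sets.sets_into_space[OF \<open>K \<in> sets M\<close>] by (auto simp: E_def)
    then show ?thesis by simp
  qed
  have Efm: "E n \<in> fmeasurable M" for n
    by (rule fmeasurableI2[OF K]) (auto simp: E_def)
  have "(\<lambda>n. measure M (E n)) \<longlonglongrightarrow> measure M (\<Inter>n. E n)"
  proof (rule Lim_measure_decseq)
    show "decseq E"
      by (auto simp: decseq_def E_def intro!: frac_le elim!: order_trans)
    show "emeasure M (E n) \<noteq> \<infinity>" for n using Efm[of n] by (auto simp: fmeasurable_def)
  qed auto
  moreover have "(\<Inter>n. E n) = {}"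
  proof -
    have "\<exists>n. t \<notin> E n" for t
    proof -
      obtain n where "1 / real (Suc n) < \<omega> t" using weight_pos[of t] nat_approx_posE by blast
      then show ?thesis by (intro exI[of _ n]) (simp add: E_def)
    qed
    then show ?thesis by blast
  qed
  ultimately have "eventually (\<lambda>n. measure M (E n) < e / 2) sequentially"
    using \<open>0 < e\<close> by (intro order_tendstoD(2)) auto
  then obtain n where n: "measure M (E n) < e / 2"
    by (auto simp: eventually_sequentially)
  \<comment> \<open>Outside \<open>E n\<close> the weight exceeds \<open>1 / Suc n\<close>, so
    \<open>a \<le> cmod (h t)\<close> implies \<open>b \<le> cmod (h t) * \<omega> t\<close>, and
    \<open>markov\<close> applies at level \<open>b\<close>.\<close>
  define b where "b = a / real (Suc n)"
  have b: "0 < b" using \<open>0 < a\<close> by (simp add: b_def)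
  \<comment> \<open>Chosen so that \<open>(\<delta> / b) powr p = e / 2\<close>.\<close>
  define \<delta> where "\<delta> = b * (e / 2) powr (1 / p)"
  have \<delta>: "0 < \<delta>" using b \<open>0 < e\<close> by (simp add: \<delta>_def)
  have "measure M {t \<in> K. a \<le> cmod (h t)} < e" if h: "h \<in> L" and small: "N h < \<delta>" for h
  proof -
    have [measurable]: "h \<in> borel_measurable M" using h by (rule L_measurable)
    define B where "B = {t \<in> space M. b \<le> cmod (h t) * \<omega> t}"
    have [measurable]: "B \<in> sets M" unfolding B_def by measurable
    have "N h / b < (e / 2) powr (1 / p)" using small b by (simp add: \<delta>_def field_simps)
    then have "(N h / b) powr p < ((e / 2) powr (1 / p)) powr p"
      using b p_ge_1 by (intro powr_less_mono2) auto
    also have "\<dots> = e / 2" using p_ge_1 \<open>0 < e\<close> by (simp add: powr_powr)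
    finally have "(N h / b) powr p < e / 2" .
    then have B: "emeasure M B < ennreal (e / 2)"
      unfolding B_def using \<open>0 < e\<close> by (intro le_less_trans[OF markov[OF h b]] ennreal_lessI) auto
    then have Bfm: "B \<in> fmeasurable M" by (intro fmeasurableI) (auto intro: less_trans)
    have B': "measure M B < e / 2"
      using B Bfm \<open>0 < e\<close> by (simp add: emeasure_eq_measure2 ennreal_less_iff)
    have "{t \<in> K. a \<le> cmod (h t)} \<subseteq> E n \<union> B"
    proof
      fix t assume t: "t \<in> {t \<in> K. a \<le> cmod (h t)}"
      show "t \<in> E n \<union> B"
      proof (cases "t \<in> E n")
        case False
        then have "1 / real (Suc n) \<le> \<omega> t" using t by (auto simp: E_def)
        then have "b \<le> cmod (h t) * \<omega> t"
          using t \<open>0 < a\<close> mult_mono[of a "cmod (h t)" "1 / real (Suc n)" "\<omega> t"] by (simp add: b_def)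
        then show ?thesis
          using t sets.sets_into_space[OF \<open>K \<in> sets M\<close>] by (auto simp: B_def)
      qed simp
    qed
    then have "measure M {t \<in> K. a \<le> cmod (h t)} \<le> measure M (E n \<union> B)"
      using Efm Bfm level_set_fmeasurable[OF K] by (intro measure_mono_fmeasurable) auto
    also have "\<dots> \<le> measure M (E n) + measure M B" by (rule measure_Un_le) auto
    finally show ?thesis using n B' by simp
  qed
  then show ?thesis using that \<delta> by blast
qed

section \<open>Reduction of approximation to indicator functions\<close>

text \<open>For \<open>D \<subseteq> L\<close> this says that the class of \<open>f\<close> lies in
  the closure of the classes of \<open>D\<close>; stating it for functions avoids choosing
  representatives.\<close>

definition approximable :: "('a \<Rightarrow> complex) set \<Rightarrow> ('a \<Rightarrow> complex) \<Rightarrow> bool" where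
  "approximable D f \<longleftrightarrow> f \<in> L \<and> (\<forall>e>0. \<exists>d\<in>D. N (\<lambda>t. f t - d t) < e)"

lemma approximable_limit:
  assumes "D \<subseteq> L" "f \<in> L" "\<And>e. 0 < e \<Longrightarrow> \<exists>g. approximable D g \<and> N (\<lambda>t. f t - g t) < e"
  shows "approximable D f"
  unfolding approximable_def
proof (intro conjI allI impI)
  fix e :: real assume "0 < e"
  then obtain g where g: "approximable D g" "N (\<lambda>t. f t - g t) < e / 2"
    using assms(3)[of "e / 2"] by auto
  obtain d where d: "d \<in> D" "N (\<lambda>t. g t - d t) < e / 2"
    using g(1) \<open>0 < e\<close> unfolding approximable_def by (meson half_gt_zero)
  have "N (\<lambda>t. f t - d t) \<le> N (\<lambda>t. f t - g t) + N (\<lambda>t. g t - d t)"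
    using assms g d by (intro N_triangle) (auto simp: approximable_def)
  then show "\<exists>d\<in>D. N (\<lambda>t. f t - d t) < e" using d g by (intro bexI[of _ d]) auto
qed (rule assms(2))

lemma approximable_dominated:
  assumes "D \<subseteq> L" "\<And>n. approximable D (F n)" and h: "h \<in> L" and f: "f \<in> borel_measurable M"
    and bound: "\<And>n. AE t in M. cmod (F n t) \<le> cmod (h t)"
    and lim: "AE t in M. (\<lambda>n. F n t) \<longlonglongrightarrow> f t"
  shows "approximable D f"
proof (rule approximable_limit[OF assms(1)])
  have F: "F n \<in> borel_measurable M" for n using assms(2)[of n] by (auto simp: approximable_def L_iff)
  show "f \<in> L" by (rule N_dominated_convergence(1)[OF h f F bound lim zero_less_one])
  show "\<exists>g. approximable D g \<and> N (\<lambda>t. f t - g t) < e" if "0 < e" for e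
    using N_dominated_convergence(3)[OF h f F bound lim that] assms(2) by blast
qed

lemma approximable_add:
  assumes "D \<subseteq> L" "\<And>c d. c \<in> D \<Longrightarrow> d \<in> D \<Longrightarrow> (\<lambda>t. c t + d t) \<in> D"
    and f: "approximable D f" and g: "approximable D g"
  shows "approximable D (\<lambda>t. f t + g t)"
  unfolding approximable_def
proof (intro conjI allI impI)
  show "(\<lambda>t. f t + g t) \<in> L" using f g by (auto simp: approximable_def intro: minkowski)
  fix e :: real assume "0 < e"
  then have e: "0 < e / 2" by simp
  obtain c d where cd: "c \<in> D" "N (\<lambda>t. f t - c t) < e / 2" "d \<in> D" "N (\<lambda>t. g t - d t) < e / 2"
    using f g e unfolding approximable_def by meson
  have "N (\<lambda>t. (f t - c t) + (g t - d t)) \<le> N (\<lambda>t. f t - c t) + N (\<lambda>t. g t - d t)"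
    using f g cd assms(1) by (intro minkowski(2) L_diff) (auto simp: approximable_def)
  then have "N (\<lambda>t. (f t + g t) - (c t + d t)) < e" using cd by (simp add: algebra_simps)
  then show "\<exists>d\<in>D. N (\<lambda>t. f t + g t - d t) < e" using assms(2)[OF cd(1,3)] by (rule bexI)
qed

text \<open>Simple functions bounded by \<open>2 * cmod (f t)\<close> converge to \<open>f\<close>,
  so it suffices to approximate these. Each is a finite sum of multiples of indicators of its
  fibres, and closure of \<open>D\<close> under addition handles the sum.\<close>

lemma approximable_all:
  assumes D: "D \<subseteq> L" "\<And>c d. c \<in> D \<Longrightarrow> d \<in> D \<Longrightarrow> (\<lambda>t. c t + d t) \<in> D"
    and zero: "approximable D (\<lambda>_. 0)"
    and ind: "\<And>A c. A \<in> sets M \<Longrightarrow> indicator A \<in> L \<Longrightarrow> approximable D (\<lambda>t. c * indicator A t)"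
    and f: "f \<in> L"
  shows "approximable D f"
proof -
  have [measurable]: "f \<in> borel_measurable M" using f by (rule L_measurable)
  from borel_measurable_implies_sequence_metric[OF \<open>f \<in> borel_measurable M\<close>, of 0]
  obtain F where F': "(\<forall>i. simple_function M (F i)) \<and> (\<forall>t\<in>space M. (\<lambda>i. F i t) \<longlonglongrightarrow> f t) \<and>
    (\<forall>i. \<forall>t\<in>space M. dist (F i t) 0 \<le> 2 * dist (f t) 0)"
    by (rule exE)
  then have F: "\<And>i. simple_function M (F i)" "\<And>t. t \<in> space M \<Longrightarrow> (\<lambda>i. F i t) \<longlonglongrightarrow> f t"
    "\<And>i t. t \<in> space M \<Longrightarrow> cmod (F i t) \<le> 2 * cmod (f t)"
    by simp_all
  have sum: "approximable D (\<lambda>t. \<Sum>y\<in>Y. G y t)" if "finite Y" "\<And>y. y \<in> Y \<Longrightarrow> approximable D (G y)"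
    for Y :: "complex set" and G
    using that by (induction Y) (auto intro!: zero approximable_add[OF D])
  have "approximable D (F i)" for i
  proof -
    have fin: "finite (F i ` space M)" and Fs: "\<And>y. F i -` {y} \<inter> space M \<in> sets M"
      using simple_functionD[OF F(1)[of i]] by auto
    have FL: "F i \<in> L"
      using F(3)[of _ i] borel_measurable_simple_function[OF F(1)[of i]]
      by (intro L_bounded[OF L_scale[OF f, of 2]]) (auto simp: norm_mult)
    have *: "approximable D (\<lambda>t. y * indicator (F i -` {y} \<inter> space M) t)" if "y \<in> F i ` space M" for y
    proof (cases "y = 0")
      case True
      then show ?thesis using zero by simp
    next
      case False
      \<comment> \<open>For \<open>y \<noteq> 0\<close> the indicator of the fibre is bounded by
        \<open>cmod (F i t / y)\<close>. The fibre over 0 may have an indicator outside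
        \<open>L\<close>, but it contributes nothing to the sum and was treated apart.\<close>
      have "indicator (F i -` {y} \<inter> space M) \<in> L"
        using False Fs
        by (intro L_bounded[OF L_scale[OF FL, of "1 / y"]]) (auto simp: indicator_def)
      then show ?thesis using Fs by (rule ind[rotated])
    qed
    define G where "G t = (\<Sum>y\<in>F i ` space M. y * indicator (F i -` {y} \<inter> space M) t)" for t
    have G: "approximable D G" unfolding G_def by (rule sum[OF fin *])
    have eq: "G t = F i t" if "t \<in> space M" for t
    proof -
      have "G t = (\<Sum>y\<in>F i ` space M. if y = F i t then y else 0)"
        unfolding G_def using that by (intro sum.cong) (auto simp: indicator_def)
      then show ?thesis using fin that by simp
    qed
    \<comment> \<open>\<open>G\<close> and \<open>F i\<close> are known to agree only on
      \<open>space M\<close>; the constant sequence \<open>G\<close> transfers the approximation to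
      \<open>F i\<close>.\<close>
    show ?thesis
    proof (rule approximable_dominated[OF D(1) G FL L_measurable[OF FL]])
      show "AE t in M. cmod (G t) \<le> cmod (F i t)" by (rule AE_I2) (simp add: eq)
      show "AE t in M. (\<lambda>n. G t) \<longlonglongrightarrow> F i t" by (rule AE_I2) (simp add: eq)
    qed
  qed
  then show ?thesis
  proof (rule approximable_dominated[OF D(1) _ L_scale[OF f, of 2] L_measurable[OF f]])
    show "AE t in M. cmod (F n t) \<le> cmod (2 * f t)" for n
      by (rule AE_I2) (simp add: norm_mult F(3))
    show "AE t in M. (\<lambda>n. F n t) \<longlonglongrightarrow> f t" by (rule AE_I2) (rule F(2))
  qed
qed

end

section \<open>Haar measure: translation invariance, regularity, positivity on open sets\<close>

lemma measure_sym_diff_triangle: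
  assumes "A \<in> fmeasurable M" "B \<in> fmeasurable M" "C \<in> fmeasurable M"
  shows "measure M (sym_diff A C) \<le> measure M (sym_diff A B) + measure M (sym_diff B C)"
proof -
  have "measure M (sym_diff A C) \<le> measure M (sym_diff A B \<union> sym_diff B C)"
    using assms by (intro measure_mono_fmeasurable) auto
  also have "\<dots> \<le> measure M (sym_diff A B) + measure M (sym_diff B C)"
    using assms by (intro measure_Un_le) auto
  finally show ?thesis .
qed

locale haar_group =
  fixes M :: "'a::{topological_group_add, t2_space} measure"
  assumes haar: "left_haar_measure M"
    and locally_compact: "locally_compact_space (euclidean :: 'a topology)"
begin

lemmas haar_conjuncts = haar[unfolded left_haar_measure_def]

lemma sets_M [measurable_cong]: "sets M = sets borel"
  by (rule haar_conjuncts[THEN conjunct1])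

lemma emeasure_UNIV_neq_0: "emeasure M UNIV \<noteq> 0"
  by (rule haar_conjuncts[THEN conjunct2, THEN conjunct1])

lemma emeasure_translate: "A \<in> sets M \<Longrightarrow> emeasure M ((+) s ` A) = emeasure M A"
  by (rule haar_conjuncts[THEN conjunct2, THEN conjunct2, THEN conjunct1, rule_format]) (simp add: sets_M)

lemma emeasure_compact: "compact K \<Longrightarrow> emeasure M K < \<infinity>"
  by (rule haar_conjuncts[THEN conjunct2, THEN conjunct2, THEN conjunct2, THEN conjunct1, rule_format])

lemma emeasure_outer: "A \<in> sets M \<Longrightarrow> emeasure M A = (INF U\<in>{U. open U \<and> A \<subseteq> U}. emeasure M U)"
  by (rule haar_conjuncts[THEN conjunct2, THEN conjunct2, THEN conjunct2, THEN conjunct2, THEN conjunct1, rule_format]) (simp add: sets_M)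

lemma emeasure_inner: "open U \<Longrightarrow> emeasure M U = (SUP K\<in>{K. compact K \<and> K \<subseteq> U}. emeasure M K)"
  by (rule haar_conjuncts[THEN conjunct2, THEN conjunct2, THEN conjunct2, THEN conjunct2, THEN conjunct2, rule_format])

lemma space_M [simp]: "space M = UNIV"
  using sets_eq_imp_space_eq[OF sets_M] by simp

text \<open>Writing a translate as a preimage lets its openness and measurability follow from
  continuity of the translation by \<open>- s\<close>, and makes translation commute with set
  operations.\<close>

lemma image_plus_eq_vimage: "(+) s ` A = (\<lambda>t. - s + t) -` A" for s :: 'a
proof (intro equalityI subsetI)
  fix t assume "t \<in> (\<lambda>t. - s + t) -` A"
  then have "s + (- s + t) \<in> (+) s ` A" by blast
  then show "t \<in> (+) s ` A" by (simp add: add.assoc[symmetric])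
qed (auto simp: add.assoc[symmetric])

lemma open_translate: "open U \<Longrightarrow> open ((+) s ` U)" for s :: 'a
  unfolding image_plus_eq_vimage by (rule open_vimage) (auto intro!: continuous_intros)

lemma compact_translate: "compact K \<Longrightarrow> compact ((+) s ` K)" for s :: 'a
  by (rule compact_continuous_image) (auto intro!: continuous_intros)

lemma sets_translate: "A \<in> sets M \<Longrightarrow> (+) s ` A \<in> sets M"
proof -
  assume A: "A \<in> sets M"
  have "(\<lambda>t. - s + t) \<in> borel_measurable borel"
    by (intro borel_measurable_continuous_onI continuous_intros)
  from measurable_sets[OF this, of A] A show ?thesis by (simp add: image_plus_eq_vimage sets_M)
qed

lemma measure_translate: "A \<in> sets M \<Longrightarrow> measure M ((+) s ` A) = measure M A"
  by (simp add: measure_def emeasure_translate)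

lemma fmeasurable_translate: "A \<in> fmeasurable M \<Longrightarrow> (+) s ` A \<in> fmeasurable M"
  by (auto simp: fmeasurable_def emeasure_translate sets_translate)

lemma AE_translate:
  assumes "AE t in M. P t"
  shows "AE t in M. P (- s + t)"
proof -
  obtain Z where Z: "{t. \<not> P t} \<subseteq> Z" "Z \<in> sets M" "emeasure M Z = 0"
    using AE_E[OF assms] by auto
  have "(+) s ` Z \<in> null_sets M" using Z by (auto simp: null_sets_def emeasure_translate sets_translate)
  then show ?thesis
    by (rule AE_I') (use Z(1) in \<open>auto simp: image_plus_eq_vimage\<close>)
qed

lemma compact_sets: "compact K \<Longrightarrow> K \<in> sets M"
  by (simp add: sets_M borel_closed compact_imp_closed)

lemma compact_fmeasurable: "compact K \<Longrightarrow> K \<in> fmeasurable M"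
  using emeasure_compact compact_sets by (auto simp: fmeasurable_def)

lemma outer_regular:
  assumes A: "A \<in> fmeasurable M" and "0 < e"
  obtains U where "open U" "A \<subseteq> U" "U \<in> fmeasurable M" "measure M (U - A) < e"
proof -
  have "(INF U\<in>{U. open U \<and> A \<subseteq> U}. emeasure M U) = emeasure M A"
    using A by (intro emeasure_outer[symmetric]) (auto simp: fmeasurable_def)
  also have "\<dots> < ennreal (measure M A + e)"
    using A \<open>0 < e\<close> by (simp add: emeasure_eq_measure2 ennreal_less_iff del: ennreal_plus)
  finally obtain U where U: "open U" "A \<subseteq> U" "emeasure M U < ennreal (measure M A + e)"
    by (auto simp: INF_less_iff)
  then have Ufm: "U \<in> fmeasurable M"
    by (intro fmeasurableI) (auto intro: less_trans)
  have "measure M (U - A) = measure M U - measure M A"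
    using A Ufm U(2) by (intro measurable_measure_Diff) auto
  also have "\<dots> < e"
    using U(3) Ufm \<open>0 < e\<close> by (simp add: emeasure_eq_measure2 ennreal_less_iff del: ennreal_plus)
  finally show ?thesis using that U Ufm by blast
qed

lemma inner_regular_open:
  assumes U: "open U" "U \<in> fmeasurable M" and "0 < e"
  obtains K where "compact K" "K \<subseteq> U" "measure M (U - K) < e"
\<comment> \<open>In the second case \<open>measure M U - e\<close> is nonnegative;
  \<open>ennreal\<close> would truncate a negative number to 0, and the strict inequality below
  could fail.\<close>
proof (cases "measure M U < e")
  case True
  then show ?thesis using that[of "{}"] by simp
next
  case False
  have "ennreal (measure M U - e) < emeasure M U"
    using U False \<open>0 < e\<close> by (simp add: emeasure_eq_measure2 ennreal_less_iff)
  also have "\<dots> = (SUP K\<in>{K. compact K \<and> K \<subseteq> U}. emeasure M K)"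
    by (rule emeasure_inner[OF U(1)])
  finally obtain K where K: "compact K" "K \<subseteq> U" "ennreal (measure M U - e) < emeasure M K"
    by (auto simp: less_SUP_iff)
  have "measure M (U - K) = measure M U - measure M K"
    using K U by (intro measurable_measure_Diff) (auto simp: compact_sets)
  also have "\<dots> < e"
    using K False compact_fmeasurable[OF K(1)] by (simp add: emeasure_eq_measure2 ennreal_less_iff)
  finally show ?thesis using that K by blast
qed

text \<open>Extends inner regularity from open sets to sets of finite measure. Take an open
  \<open>U\<close> containing \<open>A\<close>, a compact \<open>C\<close> inside \<open>U\<close>,
  and an open \<open>V\<close> of small measure containing \<open>U - A\<close>. Then
  \<open>C - V\<close> is compact, lies in \<open>A\<close> and misses little of it.\<close>

lemma inner_regular:
  assumes A: "A \<in> fmeasurable M" and e: "0 < e"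
  obtains K where "compact K" "K \<subseteq> A" "measure M (A - K) < e"
proof -
  obtain U where U: "open U" "A \<subseteq> U" "U \<in> fmeasurable M" "measure M (U - A) < e / 2"
    by (rule outer_regular[OF A half_gt_zero[OF e]])
  obtain C where C: "compact C" "C \<subseteq> U" "measure M (U - C) < e / 2"
    by (rule inner_regular_open[OF U(1,3) half_gt_zero[OF e]])
  have "U - A \<in> fmeasurable M" using U A by auto
  \<comment> \<open>This slack yields \<open>measure M V < e / 2\<close>, as \<open>V\<close>
    consists of \<open>U - A\<close> and its excess over \<open>U - A\<close>.\<close>
  moreover have "0 < e / 2 - measure M (U - A)" using U by simp
  ultimately obtain V where V: "open V" "U - A \<subseteq> V" "V \<in> fmeasurable M"
    "measure M (V - (U - A)) < e / 2 - measure M (U - A)"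
    by (rule outer_regular)
  have "measure M V \<le> measure M (V - (U - A)) + measure M (U - A)"
    using V U A measure_Un_le[of "V - (U - A)" M "U - A"] by (simp add: Un_absorb2)
  then have Vm: "measure M V < e / 2" using V(4) by simp
  have K: "compact (C - V)" using C(1) V(1) by (rule compact_diff)
  have Kfm: "C \<in> fmeasurable M" "C - V \<in> fmeasurable M" using C K compact_fmeasurable by auto
  have "measure M (A - (C - V)) \<le> measure M ((U - C) \<union> V)"
    using U V A Kfm by (intro measure_mono_fmeasurable) auto
  also have "\<dots> \<le> measure M (U - C) + measure M V"
    using U V Kfm by (intro measure_Un_le) auto
  also have "\<dots> < e" using C Vm by simp
  finally show ?thesis using that[of "C - V"] K C V by blast
qed

lemma open_sets: "open U \<Longrightarrow> U \<in> sets M"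
  by (simp add: sets_M)

text \<open>If \<open>U\<close> were null, every compact set would be null, being covered by
  finitely many translates of \<open>U\<close>; inner regularity of the whole group would then make
  the measure zero.\<close>

lemma open_pos:
  assumes U: "open U" "U \<noteq> {}"
  shows "0 < emeasure M U"
proof (rule ccontr)
  assume "\<not> 0 < emeasure M U"
  then have U0: "emeasure M U = 0" by (simp add: not_gr_zero)
  obtain u where u: "u \<in> U" using U by blast
  have K0: "emeasure M K = 0" if K: "compact K" for K
  proof -
    have "K \<subseteq> (\<Union>x\<in>K. (+) (x - u) ` U)"
      using u by (force intro!: image_eqI[of _ _ u])
    then obtain X where X: "X \<subseteq> K" "finite X" "K \<subseteq> (\<Union>x\<in>X. (+) (x - u) ` U)"
      by (rule compactE_image[OF K open_translate[OF U(1)]])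
    have "emeasure M K \<le> emeasure M (\<Union>x\<in>X. (+) (x - u) ` U)"
      using X U(1) open_translate open_sets by (intro emeasure_mono) auto
    also have "\<dots> \<le> (\<Sum>x\<in>X. emeasure M ((+) (x - u) ` U))"
      using X U(1) open_translate open_sets by (intro emeasure_subadditive_finite) auto
    also have "\<dots> = 0" using U(1) by (simp add: emeasure_translate U0 open_sets)
    finally show ?thesis by simp
  qed
  have "emeasure M UNIV = (SUP K\<in>{K. compact K \<and> K \<subseteq> UNIV}. emeasure M K)"
    by (rule emeasure_inner) simp
  also have "\<dots> \<le> 0" using K0 by (intro SUP_least) auto
  finally show False using emeasure_UNIV_neq_0 by simp
qed

lemma compact_nbhd_zero:
  obtains U K where "open U" "compact K" "(0::'a) \<in> U" "U \<subseteq> K"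
  using locally_compact unfolding locally_compact_space_def by simp metis

lemma open_contains_compact_pos:
  assumes U: "open U" "U \<noteq> {}"
  obtains A where "compact A" "A \<subseteq> U" "0 < measure M A"
proof -
  have "0 < (SUP K\<in>{K. compact K \<and> K \<subseteq> U}. emeasure M K)"
    using open_pos[OF U] emeasure_inner[OF U(1)] by simp
  then obtain A where A: "compact A" "A \<subseteq> U" "0 < emeasure M A" by (auto simp: less_SUP_iff)
  then have "0 < measure M A" using compact_fmeasurable[OF A(1)] by (simp add: emeasure_eq_measure2)
  then show ?thesis using that A by blast
qed

section \<open>Continuity of translation in measure, and countable bases\<close>

lemma nbhd_zero_difference:
  assumes "open W" "(0::'a) \<in> W"
  obtains U where "open U" "0 \<in> U" "\<forall>x\<in>U. \<forall>y\<in>U. x - y \<in> W"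
proof -
  have "open ((\<lambda>(x, y). x - y) -` W)"
    using assms(1) by (intro open_vimage) (auto simp: case_prod_unfold diff_conv_add_uminus simp del: add_uminus_conv_diff intro!: continuous_intros)
  moreover have "(0, 0) \<in> (\<lambda>(x, y). x - y) -` W" using assms by simp
  ultimately obtain A B where "open A" "open B" "(0, 0) \<in> A \<times> B" "A \<times> B \<subseteq> (\<lambda>(x, y). x - y) -` W"
    by (elim open_prod_elim)
  then show ?thesis by (intro that[of "A \<inter> B"]) auto
qed

text \<open>Take an open \<open>U\<close> containing \<open>C\<close> with little excess. By the
  tube lemma \<open>x + C\<close> stays in \<open>U\<close> for \<open>x\<close> near 0, so the part
  of \<open>x + C\<close> outside \<open>C\<close> is small. The part of \<open>C\<close> outside
  \<open>x + C\<close> has the same measure, because \<open>C\<close> and \<open>x + C\<close> have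
  equal finite measure.\<close>

lemma translate_continuous_zero:
  assumes C: "compact C" and e: "0 < e"
  obtains V where "open V" "0 \<in> V" "\<forall>x\<in>V. measure M (sym_diff ((+) x ` C) C) < e"
proof -
  obtain U where U: "open U" "C \<subseteq> U" "U \<in> fmeasurable M" "measure M (U - C) < e / 2"
    by (rule outer_regular[OF compact_fmeasurable[OF C] half_gt_zero[OF e]])
  have op: "open ((\<lambda>(x, y). x + y) -` U)"
    using U(1) by (intro open_vimage) (auto simp: case_prod_unfold intro!: continuous_intros)
  have "{0} \<times> C \<subseteq> (\<lambda>(x, y). x + y) -` U" using U by auto
  from Elementary_Topology.tube_lemma[OF C op this]
  obtain V where V: "0 \<in> V" "open V" "V \<times> C \<subseteq> (\<lambda>(x, y). x + y) -` U"
    by (elim exE conjE)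
  have "measure M (sym_diff ((+) x ` C) C) < e" if "x \<in> V" for x
  proof -
    have fm: "C \<in> fmeasurable M" "(+) x ` C \<in> fmeasurable M"
      using compact_fmeasurable[OF C] fmeasurable_translate by auto
    have sub: "(+) x ` C \<subseteq> U" using V that by auto
    have "measure M ((+) x ` C - C) \<le> measure M (U - C)"
      using sub fm U by (intro measure_mono_fmeasurable) auto
    then have 1: "measure M ((+) x ` C - C) < e / 2" using U by simp
    have eq: "measure M ((+) x ` C) = measure M C" using fm(1) by (intro measure_translate) auto
    have "measure M (C - (+) x ` C) = measure M C - measure M (C \<inter> (+) x ` C)"
      using fm measurable_measure_Diff[of C M "C \<inter> (+) x ` C"] by (simp add: Diff_Int)
    also have "\<dots> = measure M ((+) x ` C - C)"
      using fm measurable_measure_Diff[of "(+) x ` C" M "C \<inter> (+) x ` C"] eq by (simp add: Diff_Int)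
    finally have 2: "measure M (C - (+) x ` C) < e / 2" using 1 by simp
    have "measure M (sym_diff ((+) x ` C) C) \<le> measure M ((+) x ` C - C) + measure M (C - (+) x ` C)"
      using fm by (intro measure_Un_le) auto
    then show ?thesis using 1 2 by simp
  qed
  then show ?thesis using that V by blast
qed

text \<open>Finitely many translates \<open>x + V\<close> of a neighbourhood from
  \<open>translate_continuous_zero\<close> cover \<open>L\<close>. If \<open>s = x + v\<close>, left
  invariance reduces the comparison of \<open>s + C\<close> with \<open>x + C\<close> to that of
  \<open>v + C\<close> with \<open>C\<close>.\<close>

lemma finite_translate_net:
  assumes C: "compact C" and L: "compact L" and e: "0 < e"
  obtains X where "finite X" "X \<subseteq> L" 
    "\<forall>s\<in>L. \<exists>x\<in>X. measure M (sym_diff ((+) s ` C) ((+) x ` C)) < e"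
proof -
  obtain V where V: "open V" "0 \<in> V" "\<forall>x\<in>V. measure M (sym_diff ((+) x ` C) C) < e"
    by (rule translate_continuous_zero[OF C e])
  have "L \<subseteq> (\<Union>x\<in>L. (+) x ` V)" using V(2) by (force intro!: image_eqI[of _ _ 0])
  then obtain X where X: "X \<subseteq> L" "finite X" "L \<subseteq> (\<Union>x\<in>X. (+) x ` V)"
    by (rule compactE_image[OF L open_translate[OF V(1)]])
  have "\<exists>x\<in>X. measure M (sym_diff ((+) s ` C) ((+) x ` C)) < e" if s: "s \<in> L" for s
  proof -
    obtain x v where xv: "x \<in> X" "v \<in> V" "s = x + v" using X(3) s by blast
    have "sym_diff ((+) s ` C) ((+) x ` C) = (+) x ` sym_diff ((+) v ` C) C"
      unfolding xv image_plus_eq_vimage by (auto simp: minus_add add.assoc diff_conv_add_uminus simp del: add_uminus_conv_diff)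
    moreover have "sym_diff ((+) v ` C) C \<in> sets M"
      using compact_translate[OF C] C compact_sets by (metis sets.Diff sets.Un)
    ultimately have "measure M (sym_diff ((+) s ` C) ((+) x ` C)) = measure M (sym_diff ((+) v ` C) C)"
      by (simp only: measure_translate)
    then show ?thesis using V(3)[rule_format, OF xv(2)] xv(1) by (intro bexI[of _ x]) simp_all
  qed
  then show ?thesis using that X by blast
qed

text \<open>If \<open>A - A\<close> lies in \<open>W\<close> then \<open>x + A\<close> and \<open>A\<close> are disjoint for \<open>x\<close> outside \<open>W\<close>. Hence the sets
  of those \<open>x\<close> for which the symmetric difference of \<open>x + D\<close> and \<open>D\<close> is small form a neighbourhood
  base as soon as the sets \<open>D\<close> approximate all such \<open>A\<close>.\<close>

lemma countable_nbhd_base: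
  assumes K: "K \<in> fmeasurable M" and U: "open U" "0 \<in> U" "U \<subseteq> K"
    and B: "countable \<B>" "\<B> \<subseteq> sets M"
    and approx: "\<And>A e. compact A \<Longrightarrow> A \<subseteq> K \<Longrightarrow> 0 < e \<Longrightarrow> \<exists>B\<in>\<B>. measure M (K \<inter> sym_diff A B) < e"
  obtains \<V> where "countable \<V>" "\<forall>V\<in>\<V>. open V \<and> 0 \<in> V"
    "\<forall>W. open W \<longrightarrow> (0::'a) \<in> W \<longrightarrow> (\<exists>V\<in>\<V>. V \<subseteq> W)"
proof -
  have fm: "A \<in> fmeasurable M" if "compact A" for A using that by (rule compact_fmeasurable)
  \<comment> \<open>The approximants are replaced by compact subsets because
    \<open>translate_continuous_zero\<close> concerns compact sets.\<close>
  define C where "C = (\<lambda>(B, n::nat). SOME C. compact C \<and> C \<subseteq> K \<inter> B \<and> measure M (K \<inter> B - C) < 1 / Suc n)"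
  have C: "compact (C (B, n))" "C (B, n) \<subseteq> K \<inter> B" "measure M (K \<inter> B - C (B, n)) < 1 / Suc n"
    if "B \<in> \<B>" for B n
  proof -
    have "K \<inter> B \<in> fmeasurable M" using K B(2) that by (auto intro: fmeasurable_Int_fmeasurable)
    then have "\<exists>C. compact C \<and> C \<subseteq> K \<inter> B \<and> measure M (K \<inter> B - C) < 1 / Suc n"
      by (rule inner_regular[of "K \<inter> B" "1 / Suc n"]) auto
    from someI_ex[OF this] show "compact (C (B, n))" "C (B, n) \<subseteq> K \<inter> B" "measure M (K \<inter> B - C (B, n)) < 1 / Suc n"
      by (auto simp: C_def)
  qed
  define V where "V = (\<lambda>(D, n::nat). SOME V. open V \<and> 0 \<in> V \<and> (\<forall>x\<in>V. measure M (sym_diff ((+) x ` D) D) < 1 / Suc n))"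
  have V: "open (V (D, n))" "0 \<in> V (D, n)" "\<And>x. x \<in> V (D, n) \<Longrightarrow> measure M (sym_diff ((+) x ` D) D) < 1 / Suc n"
    if D: "compact D" for D n
  proof -
    have "\<exists>V. open V \<and> 0 \<in> V \<and> (\<forall>x\<in>V. measure M (sym_diff ((+) x ` D) D) < 1 / Suc n)"
      by (rule translate_continuous_zero[OF D, of "1 / Suc n"]) auto
    from someI_ex[OF this] show "open (V (D, n))" "0 \<in> V (D, n)"
      "\<And>x. x \<in> V (D, n) \<Longrightarrow> measure M (sym_diff ((+) x ` D) D) < 1 / Suc n"
      by (auto simp: V_def)
  qed
  define \<V> where "\<V> = V ` ((C ` (\<B> \<times> UNIV)) \<times> UNIV)"
  show ?thesis
  proof
    show "countable \<V>" unfolding \<V>_def using B(1) by auto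
    show "\<forall>X\<in>\<V>. open X \<and> 0 \<in> X" using C(1) V by (auto simp: \<V>_def)
    show "\<forall>W. open W \<longrightarrow> (0::'a) \<in> W \<longrightarrow> (\<exists>V\<in>\<V>. V \<subseteq> W)"
    proof (intro allI impI)
      fix W :: "'a set" assume W: "open W" "0 \<in> W"
      obtain T where T: "open T" "0 \<in> T" "\<forall>x\<in>T. \<forall>y\<in>T. x - y \<in> W"
        by (rule nbhd_zero_difference[OF W])
      \<comment> \<open>Inside \<open>T\<close> the set \<open>A\<close> has its differences in
        \<open>W\<close>; inside \<open>U\<close>, hence inside \<open>K\<close>, it falls under the
        hypothesis \<open>approx\<close>.\<close>
      obtain A where A: "compact A" "A \<subseteq> T \<inter> U" "0 < measure M A"
      proof (rule open_contains_compact_pos)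
        show "open (T \<inter> U)" "T \<inter> U \<noteq> {}" using T U by auto
      qed
      let ?a = "measure M A"
      \<comment> \<open>The fraction 1/4 leaves room: \<open>A\<close> and \<open>D\<close> will
        differ by less than \<open>?a / 2\<close>, and moving \<open>D\<close> by a point of
        \<open>V (D, n)\<close> costs less than \<open>?a / 4\<close>. If \<open>x + A\<close> and
        \<open>A\<close> were disjoint, \<open>2 * ?a\<close> would be smaller than
        \<open>5 / 4 * ?a\<close>.\<close>
      obtain B where B: "B \<in> \<B>" "measure M (K \<inter> sym_diff A B) < ?a / 4"
        using approx[OF A(1), of "?a / 4"] A U by auto
      have Bm: "B \<in> sets M" using assms(6) B(1) by blast
      obtain n where n: "1 / real (Suc n) < ?a / 4"
        using nat_approx_posE[of "?a / 4"] A(3) by auto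
      define D where "D = C (B, n)"
      have D: "compact D" "D \<subseteq> K \<inter> B" "measure M (K \<inter> B - D) < ?a / 4"
        using C[OF B(1), of n] n unfolding D_def by auto
      have Dm: "D \<in> sets M" "A \<in> sets M" "K \<in> sets M" using D(1) A(1) K compact_sets by auto
      have "measure M (sym_diff A D) \<le> measure M ((K \<inter> sym_diff A B) \<union> (K \<inter> B - D))"
      proof (rule measure_mono_fmeasurable)
        show "sym_diff A D \<subseteq> (K \<inter> sym_diff A B) \<union> (K \<inter> B - D)" using A U D by blast
        show "sym_diff A D \<in> sets M" using Dm by auto
        have "(K \<inter> sym_diff A B) \<union> (K \<inter> B - D) \<in> sets M" using Dm Bm by auto
        then show "(K \<inter> sym_diff A B) \<union> (K \<inter> B - D) \<in> fmeasurable M"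
          by (rule fmeasurableI2[OF K, rotated]) blast
      qed
      also have "\<dots> \<le> measure M (K \<inter> sym_diff A B) + measure M (K \<inter> B - D)"
        using Dm Bm by (intro measure_Un_le) auto
      finally have AD: "measure M (sym_diff A D) < ?a / 2" using B(2) D(3) by simp
      have "V (D, n) \<subseteq> W"
      proof
        fix x assume x: "x \<in> V (D, n)"
        show "x \<in> W"
        proof (rule ccontr)
          assume "x \<notin> W"
          have disj: "(+) x ` A \<inter> A = {}"
          proof (rule ccontr)
            assume "(+) x ` A \<inter> A \<noteq> {}"
            then obtain t where "t \<in> A" "x + t \<in> A" by blast
            then have "x + t - t \<in> W" using T(3) A(2) by blast
            then show False using \<open>x \<notin> W\<close> by simp
          qed
          have fms: "A \<in> fmeasurable M" "D \<in> fmeasurable M" "(+) x ` A \<in> fmeasurable M" "(+) x ` D \<in> fmeasurable M"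
            using fm A D compact_translate by auto
          have "sym_diff ((+) x ` A) A = (+) x ` A \<union> A" using disj by blast
          then have "measure M (sym_diff ((+) x ` A) A) = measure M ((+) x ` A) + measure M A"
            using disj fms by (simp add: measure_Un2 Int_commute Diff_triv)
          also have "measure M ((+) x ` A) = ?a" using Dm by (intro measure_translate)
          finally have "2 * ?a = measure M (sym_diff ((+) x ` A) A)" by simp
          also have "\<dots> \<le> measure M (sym_diff ((+) x ` A) ((+) x ` D)) + measure M (sym_diff ((+) x ` D) A)"
            using fms by (intro measure_sym_diff_triangle)
          also have "measure M (sym_diff ((+) x ` D) A) \<le> measure M (sym_diff ((+) x ` D) D) + measure M (sym_diff D A)"
            using fms by (intro measure_sym_diff_triangle)
          also have "sym_diff ((+) x ` A) ((+) x ` D) = (+) x ` sym_diff A D"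
            unfolding image_plus_eq_vimage by auto
          also have "measure M ((+) x ` sym_diff A D) = measure M (sym_diff A D)"
            using Dm by (intro measure_translate) auto
          also have "sym_diff D A = sym_diff A D" by blast
          finally have "2 * ?a \<le> measure M (sym_diff A D) + (measure M (sym_diff ((+) x ` D) D) + measure M (sym_diff A D))"
            by simp
          moreover have "measure M (sym_diff ((+) x ` D) D) < ?a / 4"
            using V(3)[OF D(1) x] n by simp
          ultimately show False using AD A(3) by linarith
        qed
      qed
      moreover have "V (D, n) \<in> \<V>" unfolding \<V>_def D_def using B(1) by auto
      ultimately show "\<exists>V\<in>\<V>. V \<subseteq> W" by blast
    qed
  qed
qed

text \<open>The translates of each \<open>V\<close> by the points of a countable cover form a base.
  A point \<open>g\<close> of an open set lies in some \<open>x + V\<close> with \<open>V\<close>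
  small, say \<open>g = x + v\<close>, and any other point \<open>x + u\<close> equals
  \<open>g + (- v + u)\<close>, hence stays near \<open>g\<close>.\<close>

lemma second_countable_from_nbhd_base:
  assumes V: "countable \<V>" "\<forall>V\<in>\<V>. open V \<and> 0 \<in> V"
    "\<forall>W. open W \<longrightarrow> (0::'a) \<in> W \<longrightarrow> (\<exists>V\<in>\<V>. V \<subseteq> W)"
    and cover: "\<And>W. open W \<Longrightarrow> (0::'a) \<in> W \<Longrightarrow> \<exists>X. countable X \<and> (\<Union>x\<in>X. (+) x ` W) = UNIV"
  shows "second_countable (euclidean :: 'a topology)"
proof -
  have "\<forall>V\<in>\<V>. \<exists>X. countable X \<and> (\<Union>x\<in>X. (+) x ` V) = UNIV"
    using V(2) cover by simp
  from bchoice[OF this]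
  obtain X where "\<forall>V\<in>\<V>. countable (X V) \<and> (\<Union>x\<in>X V. (+) x ` V) = UNIV" ..
  then have X: "\<And>V. V \<in> \<V> \<Longrightarrow> countable (X V)" "\<And>V. V \<in> \<V> \<Longrightarrow> (\<Union>x\<in>X V. (+) x ` V) = UNIV"
    by simp_all
  define \<B> where "\<B> = (\<Union>V\<in>\<V>. (\<lambda>x. (+) x ` V) ` X V)"
  show ?thesis
    unfolding second_countable_def
  proof (intro exI[of _ \<B>] conjI ballI allI impI)
    show "countable \<B>" unfolding \<B>_def using V(1) X(1) by auto
    show "openin euclidean B" if "B \<in> \<B>" for B
      using that V(2) open_translate by (auto simp: \<B>_def)
    fix O' and g :: 'a assume "openin euclidean O' \<and> g \<in> O'"
    then have O: "open O'" "g \<in> O'" by auto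
    have "open ((+) (- g) ` O')" "0 \<in> (+) (- g) ` O'"
      using O open_translate by (auto intro!: image_eqI[of _ _ g])
    then obtain W where W: "open W" "0 \<in> W" "\<forall>x\<in>W. \<forall>y\<in>W. x - y \<in> (+) (- g) ` O'"
      by (rule nbhd_zero_difference)
    \<comment> \<open>The displacement \<open>- v + u\<close> is the difference of
      \<open>- v\<close> and \<open>- u\<close>, so these inverses must lie in \<open>W\<close>;
      without commutativity it need not equal \<open>u - v\<close>.\<close>
    have "open (uminus -` W)" using W(1) by (intro open_vimage) (auto intro!: continuous_intros)
    then obtain V' where V': "V' \<in> \<V>" "V' \<subseteq> W \<inter> uminus -` W"
      using V(3)[rule_format, of "W \<inter> uminus -` W"] W by auto
    obtain x v where xv: "x \<in> X V'" "v \<in> V'" "g = x + v" using X(2)[OF V'(1)] by blast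
    have "(+) x ` V' \<subseteq> O'"
    proof
      fix t assume "t \<in> (+) x ` V'"
      then obtain u where u: "u \<in> V'" "t = x + u" by blast
      have "- v - - u \<in> (+) (- g) ` O'" using V'(2) xv(2) u(1) by (intro W(3)[rule_format]) auto
      then obtain z where z: "z \<in> O'" "- v + u = - g + z" by auto
      have "z = g + (- v + u)" using z(2) by (simp add: add.assoc[symmetric])
      also have "\<dots> = t" unfolding xv(3) u(2) by (simp add: add.assoc) 
      finally show "t \<in> O'" using z(1) by simp
    qed
    then show "\<exists>B\<in>\<B>. g \<in> B \<and> B \<subseteq> O'" using xv V'(1) by (auto simp: \<B>_def)
  qed
qed

end

section \<open>Separability of the weighted space implies second countability\<close>

locale weighted_haar_group = haar_group M + weighted_Lp M p \<omega>
  for M :: "'a::{topological_group_add, t2_space} measure" and p \<omega> +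
  assumes locally_integrable: "compact K \<Longrightarrow> (\<integral>\<^sup>+t\<in>K. ennreal (\<omega> t powr p) \<partial>M) < \<infinity>"
begin

lemma indicator_in_L:
  assumes A: "A \<in> sets M" "A \<subseteq> K" "compact K"
  shows "indicator A \<in> L"
proof -
  have "I (indicator K) = (\<integral>\<^sup>+t\<in>K. ennreal (\<omega> t powr p) \<partial>M)"
    unfolding Lp_integral_def using p_ge_1 by (intro nn_integral_cong) (auto simp: indicator_def)
  then have "indicator K \<in> L"
    using locally_integrable[OF A(3)] compact_sets[OF A(3)] by (simp add: L_iff)
  then show ?thesis
    by (rule L_bounded) (use A in \<open>auto simp: indicator_def\<close>)
qed

lemma N_indicator_open_pos:
  assumes V: "open V" "V \<noteq> {}" "indicator V \<in> L"
  shows "0 < N (indicator V)"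
proof -
  have "N (indicator V) \<noteq> 0"
  proof
    assume "N (indicator V) = 0"
    then have "AE t in M. indicator V t = (0::complex)" using N_eq_0[OF V(3)] by simp
    then have "AE t in M. t \<notin> V" by eventually_elim (auto simp: indicator_def split: if_splits)
    then have "emeasure M V = 0"
      using open_sets[OF V(1)] by (subst (asm) AE_iff_measurable[of V]) auto
    then show False using open_pos[OF V(1,2)] by simp
  qed
  then show ?thesis using N_nonneg[of "indicator V"] by linarith
qed

lemma separable_imp_second_countable:
  assumes "separable_space (Lp_topology M p \<omega>)"
  shows "second_countable (euclidean :: 'a topology)"
proof -
  obtain D where D: "D \<subseteq> L" "countable D" "\<And>f e. f \<in> L \<Longrightarrow> 0 < e \<Longrightarrow> \<exists>d\<in>D. N (\<lambda>t. f t - d t) < e"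
    using assms unfolding separable_iff by metis
  obtain U K where UK: "open U" "compact K" "(0::'a) \<in> U" "U \<subseteq> K"
    by (rule compact_nbhd_zero)
  have Kfm: "K \<in> fmeasurable M" using UK(2) by (rule compact_fmeasurable)
  define \<B> where "\<B> = (\<lambda>d::'a \<Rightarrow> complex. {t. cmod (d t - 1) < 1 / 2}) ` D"
  have \<B>: "countable \<B>" "\<B> \<subseteq> sets M"
  proof -
    show "countable \<B>" using D(2) by (simp add: \<B>_def)
    have "{t. cmod (d t - 1) < 1 / 2} \<in> sets M" if "d \<in> D" for d
    proof -
      have [measurable]: "d \<in> borel_measurable M" using D(1) that by (auto simp: L_iff)
      have "{t \<in> space M. cmod (d t - 1) < 1 / 2} \<in> sets M" by measurable
      then show ?thesis by simp
    qed
    then show "\<B> \<subseteq> sets M" by (auto simp: \<B>_def)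
  qed
  have approx: "\<exists>B\<in>\<B>. measure M (K \<inter> sym_diff A B) < e" if A: "compact A" "A \<subseteq> K" "0 < e" for A e
  proof -
    obtain \<delta> where \<delta>: "0 < \<delta>" "\<forall>h\<in>L. N h < \<delta> \<longrightarrow> measure M {t \<in> K. 1 / 2 \<le> cmod (h t)} < e"
      by (rule small_norm_imp_small_measure[OF Kfm _ A(3), of "1 / 2"]) auto
    have AL: "indicator A \<in> L" using indicator_in_L[OF compact_sets[OF A(1)] A(2) UK(2)] .
    obtain d where d: "d \<in> D" "N (\<lambda>t. indicator A t - d t) < \<delta>"
      using D(3)[OF AL \<delta>(1)] by blast
    let ?h = "\<lambda>t. indicator A t - d t"
    have hL: "?h \<in> L" using AL d(1) D(1) by (intro L_diff) auto
    let ?B = "{t. cmod (d t - 1) < 1 / 2}"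
    have B: "?B \<in> \<B>" using d(1) by (auto simp: \<B>_def)
    \<comment> \<open>Where \<open>A\<close> and \<open>?B\<close> disagree, either the indicator is
      1 and \<open>d\<close> is at distance at least 1/2 from 1, or the indicator is 0 and
      \<open>d\<close> is within 1/2 of 1.\<close>
    have "K \<inter> sym_diff A ?B \<subseteq> {t \<in> K. 1 / 2 \<le> cmod (?h t)}"
    proof
      fix t assume t: "t \<in> K \<inter> sym_diff A ?B"
      show "t \<in> {t \<in> K. 1 / 2 \<le> cmod (?h t)}"
      proof (cases "t \<in> A")
        case True
        then show ?thesis using t by (auto simp: norm_minus_commute)
      next
        case False
        then have "cmod (d t - 1) < 1 / 2" using t by auto
        moreover have "1 \<le> cmod (d t - 1) + cmod (d t)"
          using norm_triangle_ineq4[of "d t" "d t - 1"] by simp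
        ultimately show ?thesis using False t by simp
      qed
    qed
    then have "measure M (K \<inter> sym_diff A ?B) \<le> measure M {t \<in> K. 1 / 2 \<le> cmod (?h t)}"
      using B \<B>(2) compact_sets[OF A(1)] compact_sets[OF UK(2)]
      by (intro measure_mono_fmeasurable level_set_fmeasurable[OF Kfm L_measurable[OF hL]]) auto
    also have "\<dots> < e" using \<delta>(2) hL d(2) by blast
    finally show ?thesis using B by blast
  qed
  obtain \<V> where \<V>: "countable \<V>" "\<forall>V\<in>\<V>. open V \<and> 0 \<in> V"
    "\<forall>W. open W \<longrightarrow> (0::'a) \<in> W \<longrightarrow> (\<exists>V\<in>\<V>. V \<subseteq> W)"
    by (rule countable_nbhd_base[OF Kfm UK(1,3,4) \<B>]) (rule approx)
  have cover: "\<exists>X. countable X \<and> (\<Union>x\<in>X. (+) x ` W) = UNIV" if W: "open W" "(0::'a) \<in> W" for W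
  proof -
    obtain T where T: "open T" "0 \<in> T" "\<forall>x\<in>T. \<forall>y\<in>T. x - y \<in> W"
      by (rule nbhd_zero_difference[OF W])
    define i :: "'a \<Rightarrow> 'a \<Rightarrow> complex" where "i g = indicator ((+) g ` (T \<inter> U))" for g
    have op: "open ((+) g ` (T \<inter> U))" for g using T(1) UK(1) by (intro open_translate) auto
    have iL: "i g \<in> L" for g
      unfolding i_def
      by (rule indicator_in_L[OF open_sets[OF op] _ compact_translate[OF UK(2), of g]]) (use UK in auto)
    have ipos: "0 < N (i g)" for g
      unfolding i_def using T(2) UK(3) by (intro N_indicator_open_pos[OF op] iL[unfolded i_def]) auto
    \<comment> \<open>One group element is selected for each \<open>d\<close> near some
      \<open>i g\<close>; for other \<open>d\<close> the value is arbitrary and merely enlarges the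
      cover. The tolerance is relative to \<open>N (i g)\<close>, as the weighted norm need not be
      translation invariant.\<close>
    define x where "x d = (SOME g. N (\<lambda>t. i g t - d t) < N (i g) / 2)" for d
    have "\<exists>z\<in>x ` D. g \<in> (+) z ` W" for g
    proof -
      obtain d where d: "d \<in> D" "N (\<lambda>t. i g t - d t) < N (i g) / 2"
        using D(3)[OF iL, of "N (i g) / 2" g] ipos[of g] by auto
      define z where "z = x d"
      have z: "N (\<lambda>t. i z t - d t) < N (i z) / 2"
        unfolding z_def x_def by (rule someI[of "\<lambda>g. N (\<lambda>t. i g t - d t) < N (i g) / 2", OF d(2)])
      have dL: "d \<in> L" using d(1) D(1) by blast
      have "N (\<lambda>t. i g t - i z t) \<le> N (\<lambda>t. i g t - d t) + N (\<lambda>t. d t - i z t)"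
        by (intro N_triangle iL dL)
      also have "N (\<lambda>t. d t - i z t) = N (\<lambda>t. i z t - d t)" by (rule N_minus_commute)
      finally have lt: "N (\<lambda>t. i g t - i z t) < N (i g) / 2 + N (i z) / 2" using d(2) z by simp
      \<comment> \<open>For disjoint translates the difference of the indicators dominates each of
        them, so its norm would be at least the average of \<open>N (i g)\<close> and
        \<open>N (i z)\<close>.\<close>
      have "(+) g ` (T \<inter> U) \<inter> (+) z ` (T \<inter> U) \<noteq> {}"
      proof
        assume disj: "(+) g ` (T \<inter> U) \<inter> (+) z ` (T \<inter> U) = {}"
        have "N (i g) \<le> N (\<lambda>t. i g t - i z t)" "N (i z) \<le> N (\<lambda>t. i g t - i z t)"
          using disj by (intro N_mono L_diff iL; force simp: i_def indicator_def)+
        then show False using lt by linarith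
      qed
      then obtain u v where uv: "u \<in> T" "v \<in> T" "g + u = z + v" by blast
      have "g = g + u - u" by simp
      also have "\<dots> = z + (v - u)" unfolding uv(3) by (rule add_diff_eq[symmetric])
      finally have "g \<in> (+) z ` W" using T(3) uv by blast
      then show ?thesis using d(1) by (auto simp: z_def)
    qed
    then have "(\<Union>z\<in>x ` D. (+) z ` W) = UNIV" by blast
    moreover have "countable (x ` D)" using D(2) by blast
    ultimately show ?thesis by blast
  qed
  show ?thesis by (rule second_countable_from_nbhd_base[OF \<V> cover])
qed

section \<open>Dense multiples of translates imply second countability\<close>

text \<open>By \<open>markov\<close> the level sets of \<open>cmod (f t) * \<omega> t\<close> have
  finite measure, so inner regularity exhausts each by compact sets up to a null set. As
  \<open>\<omega>\<close> is positive, countably many levels reach every \<open>t\<close> with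
  \<open>f t \<noteq> 0\<close>.\<close>

lemma carrier_sigma_compact:
  assumes f: "f \<in> L"
  obtains \<C> where "countable \<C>" "\<forall>C\<in>\<C>. compact C" "AE t in M. f t \<noteq> 0 \<longrightarrow> t \<in> \<Union>\<C>"
proof -
  have [measurable]: "f \<in> borel_measurable M" using f by (rule L_measurable)
  define E where "E n = {t. 1 / real (Suc n) \<le> cmod (f t) * \<omega> t}" for n
  have Efm: "E n \<in> fmeasurable M" for n
  proof (rule fmeasurableI)
    have "{t \<in> space M. 1 / real (Suc n) \<le> cmod (f t) * \<omega> t} \<in> sets M" by measurable
    then show "E n \<in> sets M" by (simp add: E_def)
    show "emeasure M (E n) < \<infinity>"
      using markov[OF f, of "1 / real (Suc n)"] by (auto simp: E_def intro: le_less_trans)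
  qed
  have "\<exists>C. compact C \<and> C \<subseteq> E n \<and> measure M (E n - C) < 1 / Suc k" for n k
    by (rule inner_regular[OF Efm, of "1 / Suc k" n]) auto
  then obtain C where C: "\<And>n k. compact (C n k)" "\<And>n k. C n k \<subseteq> E n" "\<And>n k. measure M (E n - C n k) < 1 / Suc k"
    by metis
  have Cs: "C n k \<in> sets M" for n k using C(1) by (rule compact_sets)
  have "E n - (\<Union>k. C n k) \<in> null_sets M" for n
  proof -
    have fm: "E n - (\<Union>k. C n k) \<in> fmeasurable M"
      by (intro fmeasurable_Diff Efm sets.countable_UN) (use Cs in auto)
    have "measure M (E n - (\<Union>k. C n k)) < e" if "0 < e" for e
    proof -
      obtain k where k: "1 / real (Suc k) < e" using nat_approx_posE[OF \<open>0 < e\<close>] .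
      have "measure M (E n - (\<Union>k. C n k)) \<le> measure M (E n - C n k)"
        using fm by (intro measure_mono_fmeasurable fmeasurable_Diff[OF Efm Cs] fmeasurableD) auto
      then show ?thesis using C(3)[of n k] k by linarith
    qed
    then have "measure M (E n - (\<Union>k. C n k)) = 0"
      by (metis measure_nonneg less_irrefl less_eq_real_def)
    then show ?thesis using fm by (simp add: null_sets_def emeasure_eq_measure2 fmeasurableD)
  qed
  then have "(\<Union>n. E n - (\<Union>k. C n k)) \<in> null_sets M" by blast
  then have "AE t in M. t \<notin> (\<Union>n. E n - (\<Union>k. C n k))" by (rule AE_not_in)
  then have ae: "AE t in M. f t \<noteq> 0 \<longrightarrow> t \<in> \<Union>(range (\<lambda>(n, k). C n k))"
  proof eventually_elim
    case (elim t)
    show ?case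
    proof
      assume "f t \<noteq> 0"
      then have "0 < cmod (f t) * \<omega> t" using weight_pos by simp
      then obtain n where "1 / real (Suc n) < cmod (f t) * \<omega> t" using nat_approx_posE by blast
      then have "t \<in> E n" by (simp add: E_def)
      then obtain k where "t \<in> C n k" using elim by blast
      then show "t \<in> \<Union>(range (\<lambda>(n, k). C n k))" by auto
    qed
  qed
  show ?thesis by (rule that[of "range (\<lambda>(n, k). C n k)"]) (use C(1) ae in auto)
qed

text \<open>Approximating the indicator of \<open>A \<union> (g + A)\<close> forces some \<open>s + supp f\<close> to meet both \<open>A\<close> and
  \<open>g + A\<close>, so that \<open>g \<in> A - supp f + supp f - A\<close>.\<close>

lemma dense_translates_imp_sigma_compact:
  assumes f: "f \<in> L"
    and dense: "\<And>g e. g \<in> L \<Longrightarrow> 0 < e \<Longrightarrow>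
      \<exists>c s. (\<lambda>t. c * translate s f t) \<in> L \<and> N (\<lambda>t. g t - c * translate s f t) < e"
  obtains \<K> :: "'a set set" where "countable \<K>" "\<forall>K\<in>\<K>. compact K" "\<Union>\<K> = UNIV"
proof -
  obtain \<C> where \<C>: "countable \<C>" "\<forall>C\<in>\<C>. compact C" "AE t in M. f t \<noteq> 0 \<longrightarrow> t \<in> \<Union>\<C>"
    by (rule carrier_sigma_compact[OF f])
  obtain A :: "'a set" where A: "compact A" "0 < measure M A"
    using open_contains_compact_pos[of UNIV] by auto
  define \<K> where "\<K> = (\<lambda>(C, C'). (\<lambda>(a, u, v, b). a - u + v - b) ` (A \<times> C \<times> C' \<times> A)) ` (\<C> \<times> \<C>)"
  show ?thesis
  proof
    show "countable \<K>" using \<C>(1) by (auto simp: \<K>_def)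
    show "\<forall>K\<in>\<K>. compact K"
      using \<C>(2) A(1)
      by (auto simp: \<K>_def case_prod_unfold diff_conv_add_uminus simp del: add_uminus_conv_diff
          intro!: compact_continuous_image compact_Times continuous_intros)
    have "g \<in> \<Union>\<K>" for g
    proof -
      let ?P = "A \<union> (+) g ` A"
      have cP: "compact ?P" using A(1) compact_translate by blast
      have Pfm: "?P \<in> fmeasurable M" using cP by (rule compact_fmeasurable)
      \<comment> \<open>The threshold is \<open>measure M A\<close> because the exceptional set must
        be too small to contain \<open>A\<close> or \<open>g + A\<close>, even up to a null
        set.\<close>
      obtain \<delta> where \<delta>: "0 < \<delta>" "\<forall>h\<in>L. N h < \<delta> \<longrightarrow> measure M {t \<in> ?P. 1 / 2 \<le> cmod (h t)} < measure M A"
        by (rule small_norm_imp_small_measure[OF Pfm _ A(2), of "1 / 2"]) auto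
      have PL: "indicator ?P \<in> L" by (rule indicator_in_L[OF compact_sets[OF cP] order_refl cP])
      obtain c s where cs: "(\<lambda>t. c * translate s f t) \<in> L" "N (\<lambda>t. indicator ?P t - c * translate s f t) < \<delta>"
        using dense[OF PL \<delta>(1)] by blast
      let ?h = "\<lambda>t. indicator ?P t - c * translate s f t"
      let ?E = "{t \<in> ?P. 1 / 2 \<le> cmod (?h t)}"
      have hL: "?h \<in> L" by (rule L_diff[OF PL cs(1)])
      have Efm: "?E \<in> fmeasurable M" by (rule level_set_fmeasurable[OF Pfm L_measurable[OF hL]])
      have E: "measure M ?E < measure M A" using \<delta>(2) hL cs(2) by blast
      have ae: "AE t in M. f (- s + t) \<noteq> 0 \<longrightarrow> - s + t \<in> \<Union>\<C>" by (rule AE_translate[OF \<C>(3)])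
      \<comment> \<open>If \<open>- s + t\<close> avoided \<open>\<Union>\<C>\<close> for all
        \<open>t\<close> in \<open>Q\<close>, the translate would vanish almost everywhere on
        \<open>Q\<close>; then \<open>?h\<close> would be 1 there and \<open>Q\<close> would lie in
        \<open>?E\<close> up to a null set.\<close>
      have hit: "\<exists>t\<in>Q. - s + t \<in> \<Union>\<C>" if Q: "Q \<subseteq> ?P" "Q \<in> sets M" "measure M Q = measure M A" for Q
      proof (rule ccontr)
        assume no: "\<not> (\<exists>t\<in>Q. - s + t \<in> \<Union>\<C>)"
        have "AE t in M. t \<in> Q \<longrightarrow> t \<in> ?E"
          using ae
        proof eventually_elim
          case (elim t)
          show ?case
          proof
            assume "t \<in> Q"
            then have "t \<in> ?P" "f (- s + t) = 0" using Q(1) no elim by auto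
            then show "t \<in> ?E" by (simp add: translate_def)
          qed
        qed
        then have "emeasure M Q \<le> emeasure M ?E"
          using Efm by (intro emeasure_mono_AE) auto
        then have "measure M Q \<le> measure M ?E"
          using Efm by (auto simp: measure_def fmeasurable_def intro!: enn2real_mono)
        then show False using E Q(3) by simp
      qed
      have As: "A \<in> sets M" using A(1) by (rule compact_sets)
      obtain a where a: "a \<in> A" "- s + a \<in> \<Union>\<C>"
        using hit[of A] As by auto
      obtain t where t: "t \<in> (+) g ` A" "- s + t \<in> \<Union>\<C>"
        using hit[of "(+) g ` A"] measure_translate[OF As, of g] sets_translate[OF As, of g] by auto
      obtain b where b: "b \<in> A" "t = g + b" using t(1) by blast
      obtain C C' where CC: "C \<in> \<C>" "- s + a \<in> C" "C' \<in> \<C>" "- s + t \<in> C'" using a t by blast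
      \<comment> \<open>The unknown \<open>s\<close> cancels: with \<open>u = - s + a\<close> and
        \<open>v = - s + t\<close>, the difference \<open>a - u\<close> is \<open>s\<close>, and
        \<open>s + v\<close> is \<open>t = g + b\<close>.\<close>
      have "a - (- s + a) = s" 
        by (metis add.right_inverse add_diff_eq diff_conv_add_uminus minus_add_cancel minus_minus add.assoc)
      then have "g = a - (- s + a) + (- s + t) - b"
        by (simp add: b(2) add.assoc[symmetric])
      then have "g \<in> (\<lambda>(a, u, v, b). a - u + v - b) ` (A \<times> C \<times> C' \<times> A)"
        using a(1) b(1) CC by (intro image_eqI[of _ _ "(a, - s + a, - s + t, b)"]) auto
      then show "g \<in> \<Union>\<K>" unfolding \<K>_def using CC(1,3) by blast
    qed
    then show "\<Union>\<K> = UNIV" by blast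
  qed
qed

lemma dense_translates_imp_second_countable:
  assumes f: "f \<in> L"
    and dense: "\<And>g e. g \<in> L \<Longrightarrow> 0 < e \<Longrightarrow>
      \<exists>c s. (\<lambda>t. c * translate s f t) \<in> L \<and> N (\<lambda>t. g t - c * translate s f t) < e"
  shows "second_countable (euclidean :: 'a topology)"
proof -
  have fm: "f \<in> borel_measurable M" using f by (rule L_measurable)
  obtain \<K> :: "'a set set" where \<K>: "countable \<K>" "\<forall>K\<in>\<K>. compact K" "\<Union>\<K> = UNIV"
    by (rule dense_translates_imp_sigma_compact[OF f dense])
  obtain U K where UK: "open U" "compact K" "(0::'a) \<in> U" "U \<subseteq> K"
    by (rule compact_nbhd_zero)
  have Kfm: "K \<in> fmeasurable M" using UK(2) by (rule compact_fmeasurable)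
  obtain Q0 :: "complex set" where Q0: "countable Q0" "\<forall>X. open X \<longrightarrow> X \<noteq> {} \<longrightarrow> (\<exists>d\<in>Q0. d \<in> X)"
    using countable_dense_exists by (elim exE conjE)
  \<comment> \<open>A relative error survives multiplication by the possibly unbounded values of
    \<open>f\<close>. The element 0 is added because for \<open>c = 0\<close> only
    \<open>q = 0\<close> has relative error at most 1/5.\<close>
  define Q where "Q = insert 0 Q0"
  have Q: "\<exists>q\<in>Q. cmod (q - c) \<le> cmod c / 5" for c
  proof (cases "c = 0")
    case True
    then show ?thesis by (intro bexI[of _ 0]) (auto simp: Q_def)
  next
    case False
    then have "ball c (cmod c / 5) \<noteq> {}" by simp
    from Q0(2)[rule_format, OF open_ball this] obtain q where "q \<in> Q0" "q \<in> ball c (cmod c / 5)" ..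
    then show ?thesis by (intro bexI[of _ q]) (auto simp: Q_def dist_norm norm_minus_commute)
  qed
  define B where "B q = {t. cmod (q * f t - 1) < 1 / 2}" for q
  have Bm: "B q \<in> sets M" for q
  proof -
    have "{t \<in> space M. cmod (q * f t - 1) < 1 / 2} \<in> sets M" using fm by measurable
    then show ?thesis by (simp add: B_def)
  qed
  \<comment> \<open>Contains the points \<open>- s + t\<close> at which \<open>f\<close> is
    evaluated for \<open>s\<close> in \<open>S\<close> and \<open>t\<close> in \<open>K\<close>; its
    compactness gives \<open>B q \<inter> W S\<close> finite measure.\<close>
  define W where "W S = (\<lambda>(x, y). - x + y) ` (S \<times> K)" for S
  have W: "compact (W S)" if "compact S" for S
    unfolding W_def using that UK(2)
    by (intro compact_continuous_image compact_Times) (auto simp: case_prod_unfold intro!: continuous_intros)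
  \<comment> \<open>\<open>C\<close> is a compact core of \<open>B q \<inter> W S\<close>, and
    \<open>X\<close> a finite net for the translates of \<open>C\<close> by \<open>S\<close>; the
    finiteness of \<open>X\<close> makes the family \<open>\<B>\<close> below countable.\<close>
  define R where "R = (\<lambda>(q, S, n) (C, X). compact C \<and> C \<subseteq> B q \<inter> W S \<and> measure M (B q \<inter> W S - C) < 1 / real (Suc n)
    \<and> finite X \<and> (\<forall>s\<in>S. \<exists>x\<in>X. measure M (sym_diff ((+) s ` C) ((+) x ` C)) < 1 / real (Suc n)))"
  have "\<exists>y. R z y" if zin: "z \<in> Q \<times> \<K> \<times> UNIV" for z
  proof -
    obtain q S n where z: "z = (q, S, n)" "S \<in> \<K>" using zin by auto
    have S: "compact S" using \<K>(2) z(2) by blast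
    have n: "0 < 1 / real (Suc n)" by simp
    have "W S \<inter> B q \<in> fmeasurable M"
      by (rule fmeasurable_Int_fmeasurable[OF compact_fmeasurable[OF W[OF S]] Bm])
    then have "B q \<inter> W S \<in> fmeasurable M" by (simp add: Int_commute)
    then obtain C where C: "compact C" "C \<subseteq> B q \<inter> W S" "measure M (B q \<inter> W S - C) < 1 / real (Suc n)"
      by (rule inner_regular[OF _ n])
    obtain X where X: "finite X" "X \<subseteq> S" "\<forall>s\<in>S. \<exists>x\<in>X. measure M (sym_diff ((+) s ` C) ((+) x ` C)) < 1 / real (Suc n)"
      by (rule finite_translate_net[OF C(1) S n])
    have "R z (C, X)" unfolding R_def z(1) using C X by simp
    then show ?thesis ..
  qed
  then have "\<forall>z\<in>Q \<times> \<K> \<times> UNIV. \<exists>y. R z y" by blast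
  from bchoice[OF this] obtain r where r: "\<forall>z\<in>Q \<times> \<K> \<times> UNIV. R z (r z)" ..
  have r': "compact (fst (r (q, S, n)))" "fst (r (q, S, n)) \<subseteq> B q \<inter> W S"
    "measure M (B q \<inter> W S - fst (r (q, S, n))) < 1 / real (Suc n)" "finite (snd (r (q, S, n)))"
    "\<forall>s\<in>S. \<exists>x\<in>snd (r (q, S, n)). measure M (sym_diff ((+) s ` fst (r (q, S, n))) ((+) x ` fst (r (q, S, n)))) < 1 / real (Suc n)"
    if "q \<in> Q" "S \<in> \<K>" for q S n
    using r[rule_format, of "(q, S, n)"] that by (auto simp: R_def case_prod_unfold)
  define \<B> where "\<B> = (\<Union>z\<in>Q \<times> \<K> \<times> UNIV. (\<lambda>x. (+) x ` fst (r z)) ` snd (r z))"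
  have \<B>: "countable \<B>" "\<B> \<subseteq> sets M"
  proof -
    have "countable Q" using Q0(1) by (simp add: Q_def)
    then show "countable \<B>"
      unfolding \<B>_def using \<K>(1) r'(4)
      by (intro countable_UN countable_SIGMA) (auto intro: countable_finite)
    show "\<B> \<subseteq> sets M"
      unfolding \<B>_def using r'(1) by (auto intro!: compact_sets compact_translate)
  qed
  have approx: "\<exists>B\<in>\<B>. measure M (K \<inter> sym_diff A B) < e" if A: "compact A" "A \<subseteq> K" and e: "0 < e" for A e
  proof -
    have e3: "0 < e / 3" using e by simp
    obtain \<delta> where \<delta>: "0 < \<delta>" "\<forall>h\<in>L. N h < \<delta> \<longrightarrow> measure M {t \<in> K. 1 / 4 \<le> cmod (h t)} < e / 3"
      by (rule small_norm_imp_small_measure[OF Kfm _ e3, of "1 / 4"]) auto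
    have AL: "indicator A \<in> L" by (rule indicator_in_L[OF compact_sets[OF A(1)] A(2) UK(2)])
    obtain c s where cs: "(\<lambda>t. c * translate s f t) \<in> L" "N (\<lambda>t. indicator A t - c * translate s f t) < \<delta>"
      using dense[OF AL \<delta>(1)] by blast
    let ?h = "\<lambda>t. indicator A t - c * translate s f t"
    let ?E = "{t \<in> K. 1 / 4 \<le> cmod (?h t)}"
    have hL: "?h \<in> L" by (rule L_diff[OF AL cs(1)])
    have Efm: "?E \<in> fmeasurable M" by (rule level_set_fmeasurable[OF Kfm L_measurable[OF hL]])
    have E: "measure M ?E < e / 3" using \<delta>(2) hL cs(2) by blast
    have "s \<in> \<Union>\<K>" by (simp add: \<K>(3))
    then obtain S where S: "S \<in> \<K>" "s \<in> S" by (elim UnionE)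
    from Q[of c] obtain q where q: "q \<in> Q" "cmod (q - c) \<le> cmod c / 5" ..
    obtain n where n: "1 / real (Suc n) < e / 3" using nat_approx_posE[OF e3] .
    define C where "C = fst (r (q, S, n))"
    have C: "compact C" "C \<subseteq> B q \<inter> W S" "measure M (B q \<inter> W S - C) < e / 3"
      using r'(1,2,3)[OF q(1) S(1), of n] n by (auto simp: C_def)
    from r'(5)[OF q(1) S(1), of n, folded C_def, rule_format, OF S(2)]
    obtain x where x: "x \<in> snd (r (q, S, n))" "measure M (sym_diff ((+) s ` C) ((+) x ` C)) < 1 / real (Suc n)" ..
    \<comment> \<open>Off \<open>?E\<close> the value \<open>c * ?v\<close> differs from the
      indicator by less than 1/4. On \<open>A\<close> this gives \<open>cmod (c * ?v) < 5/4\<close>,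
      so \<open>q * ?v\<close> is within 1/4 of \<open>c * ?v\<close> and within 1/2 of 1. Off
      \<open>A\<close>, \<open>cmod (q * ?v) < 3/10\<close>, so \<open>q * ?v\<close> is farther
      than 1/2 from 1.\<close>
    have B_iff: "t \<in> A \<longleftrightarrow> - s + t \<in> B q" if "t \<in> K" "t \<notin> ?E" for t
    proof -
      let ?v = "translate s f t"
      have h: "cmod (?h t) < 1 / 4" using that by auto
      have qv: "cmod (q * ?v - c * ?v) \<le> cmod (c * ?v) / 5"
        using mult_right_mono[OF q(2), of "cmod ?v"] by (simp add: norm_mult left_diff_distrib[symmetric])
      have B: "- s + t \<in> B q \<longleftrightarrow> cmod (q * ?v - 1) < 1 / 2" by (simp add: B_def translate_def)
      show ?thesis
      proof (cases "t \<in> A")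
        case True
        then have 1: "cmod (1 - c * ?v) < 1 / 4" using h by simp
        have "cmod (c * ?v) \<le> 1 + cmod (1 - c * ?v)"
          using norm_triangle_ineq4[of 1 "1 - c * ?v"] by simp
        moreover have "cmod (q * ?v - 1) \<le> cmod (q * ?v - c * ?v) + cmod (1 - c * ?v)"
          using norm_triangle_ineq4[of "q * ?v - c * ?v" "1 - c * ?v"] by simp
        ultimately show ?thesis using True 1 qv unfolding B by linarith
      next
        case False
        then have 1: "cmod (c * ?v) < 1 / 4" using h by simp
        have "1 \<le> cmod (q * ?v - 1) + cmod (q * ?v)"
          using norm_triangle_ineq4[of "q * ?v" "q * ?v - 1"] by simp
        moreover have "cmod (q * ?v) \<le> cmod (q * ?v - c * ?v) + cmod (c * ?v)"
          using norm_triangle_ineq[of "q * ?v - c * ?v" "c * ?v"] by simp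
        ultimately show ?thesis using False 1 qv unfolding B by linarith
      qed
    qed
    let ?Y = "(+) s ` (B q \<inter> W S - C)" and ?Z = "sym_diff ((+) s ` C) ((+) x ` C)"
    \<comment> \<open>Three sources of error, each below \<open>e / 3\<close>: approximation of the
      indicator, passage to the compact core \<open>C\<close>, and replacement of \<open>s\<close>
      by the net point \<open>x\<close>.\<close>
    have sub: "K \<inter> sym_diff A ((+) x ` C) \<subseteq> (?E \<union> ?Y) \<union> ?Z"
    proof
      fix t assume t: "t \<in> K \<inter> sym_diff A ((+) x ` C)"
      show "t \<in> (?E \<union> ?Y) \<union> ?Z"
      proof (rule ccontr)
        assume no: "t \<notin> (?E \<union> ?Y) \<union> ?Z"
        then have iff: "t \<in> A \<longleftrightarrow> - s + t \<in> B q" using B_iff[of t] t by blast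
        have "t \<in> (+) x ` C \<longleftrightarrow> t \<in> (+) s ` C" using no by blast
        then have "t \<in> (+) x ` C \<longleftrightarrow> - s + t \<in> C" unfolding image_plus_eq_vimage by simp
        moreover have "- s + t \<in> W S" unfolding W_def using S(2) t by (auto intro!: image_eqI[of _ _ "(s, t)"])
        moreover have "\<not> (- s + t \<in> B q \<inter> W S - C)" using no unfolding image_plus_eq_vimage by blast
        ultimately show False using t iff C(2) by blast
      qed
    qed
    have Cs: "C \<in> sets M" using C(1) by (rule compact_sets)
    have BWC: "B q \<inter> W S - C \<in> fmeasurable M"
      using fmeasurable_Int_fmeasurable[OF compact_fmeasurable[OF W] Bm] \<K>(2) S(1) Cs
      by (simp add: Int_commute fmeasurable_Diff)
    have Yfm: "?Y \<in> fmeasurable M" by (rule fmeasurable_translate[OF BWC])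
    have Zfm: "?Z \<in> fmeasurable M"
      using fmeasurable_translate[OF compact_fmeasurable[OF C(1)]] by auto
    have "measure M (K \<inter> sym_diff A ((+) x ` C)) \<le> measure M ((?E \<union> ?Y) \<union> ?Z)"
    proof (rule measure_mono_fmeasurable[OF sub])
      show "K \<inter> sym_diff A ((+) x ` C) \<in> sets M"
        using compact_sets[OF UK(2)] compact_sets[OF A(1)] sets_translate[OF Cs] by auto
      show "(?E \<union> ?Y) \<union> ?Z \<in> fmeasurable M" by (intro fmeasurable.Un Efm Yfm Zfm)
    qed
    also have "\<dots> \<le> measure M (?E \<union> ?Y) + measure M ?Z"
      by (intro measure_Un_le fmeasurableD fmeasurable.Un Efm Yfm Zfm)
    also have "measure M (?E \<union> ?Y) \<le> measure M ?E + measure M ?Y"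
      by (intro measure_Un_le fmeasurableD Efm Yfm)
    also have "measure M ?Y = measure M (B q \<inter> W S - C)"
      by (rule measure_translate[OF fmeasurableD[OF BWC]])
    finally have "measure M (K \<inter> sym_diff A ((+) x ` C)) < e" using E C(3) x(2) n by linarith
    moreover have "(+) x ` C \<in> \<B>"
      unfolding \<B>_def C_def using x(1) q(1) S(1) by (intro UN_I[of "(q, S, n)"]) auto
    ultimately show ?thesis ..
  qed
  obtain \<V> where \<V>: "countable \<V>" "\<forall>V\<in>\<V>. open V \<and> 0 \<in> V"
    "\<forall>W. open W \<longrightarrow> (0::'a) \<in> W \<longrightarrow> (\<exists>V\<in>\<V>. V \<subseteq> W)"
    by (rule countable_nbhd_base[OF Kfm UK(1,3,4) \<B>]) (rule approx)
  have cover: "\<exists>X. countable X \<and> (\<Union>x\<in>X. (+) x ` V) = UNIV" if V: "open V" "(0::'a) \<in> V" for V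
  proof -
    have "\<exists>X. finite X \<and> S \<subseteq> (\<Union>x\<in>X. (+) x ` V)" if "S \<in> \<K>" for S
    proof -
      have S: "compact S" using \<K>(2) that by blast
      have "S \<subseteq> (\<Union>x\<in>S. (+) x ` V)" using V(2) by (force intro!: image_eqI[of _ _ 0])
      then show ?thesis by (rule compactE_image[OF S open_translate[OF V(1)]]) blast
    qed
    then have "\<forall>S\<in>\<K>. \<exists>X. finite X \<and> S \<subseteq> (\<Union>x\<in>X. (+) x ` V)" by blast
    from bchoice[OF this] obtain X where X: "\<forall>S\<in>\<K>. finite (X S) \<and> S \<subseteq> (\<Union>x\<in>X S. (+) x ` V)" ..
    have "countable (\<Union>S\<in>\<K>. X S)" using \<K>(1) X by (intro countable_UN) (auto intro: countable_finite)
    moreover have "(\<Union>x\<in>(\<Union>S\<in>\<K>. X S). (+) x ` V) = UNIV"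
    proof -
      have "\<Union>\<K> \<subseteq> (\<Union>x\<in>(\<Union>S\<in>\<K>. X S). (+) x ` V)" using X by blast
      then show ?thesis by (simp add: \<K>(3) top.extremum_unique)
    qed
    ultimately show ?thesis by blast
  qed
  show ?thesis by (rule second_countable_from_nbhd_base[OF \<V> cover])
qed

section \<open>Second countability implies separability\<close>

text \<open>Sums of indicators of finite unions of relatively compact base sets, with coefficients
  in a countable dense set, are dense. Increasing unions reach the open subsets of a member of
  \<open>\<U>\<close>, outer regularity its Borel subsets, and exhaustion of the group all
  measurable sets with indicator in \<open>L\<close>; \<open>approximable_all\<close> does the
  rest.\<close>

lemma second_countable_imp_separable:
  assumes "second_countable (euclidean :: 'a topology)"
  shows "separable_space (Lp_topology M p \<omega>)"
proof -
  obtain \<B>0 :: "'a set set" where \<B>0: "countable \<B>0" "\<forall>V\<in>\<B>0. open V"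
    "\<forall>U x. open U \<and> x \<in> U \<longrightarrow> (\<exists>V\<in>\<B>0. x \<in> V \<and> V \<subseteq> U)"
    using assms unfolding second_countable_def open_openin[symmetric] by (elim exE conjE)
  obtain U0 K0 where UK: "open U0" "compact K0" "(0::'a) \<in> U0" "U0 \<subseteq> K0"
    by (rule compact_nbhd_zero)
  \<comment> \<open>The empty set is added so that the family \<open>S\<close> below, enumerated by
    \<open>from_nat_into\<close>, is never empty.\<close>
  define \<B> where "\<B> = insert {} {B \<in> \<B>0. \<exists>K. compact K \<and> B \<subseteq> K}"
  have \<B>: "countable \<B>" "\<And>B. B \<in> \<B> \<Longrightarrow> open B" "\<And>B. B \<in> \<B> \<Longrightarrow> \<exists>K. compact K \<and> B \<subseteq> K"
    using \<B>0(1,2) by (auto simp: \<B>_def)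
  have base: "\<exists>B\<in>\<B>. x \<in> B \<and> B \<subseteq> U" if "open U" "x \<in> U" for x U
  proof -
    have "open (U \<inter> (+) x ` U0)" using that UK(1) open_translate by blast
    moreover have "x \<in> U \<inter> (+) x ` U0" using that UK(3) by (auto intro!: image_eqI[of _ _ 0])
    ultimately obtain B where B: "B \<in> \<B>0" "x \<in> B" "B \<subseteq> U \<inter> (+) x ` U0" using \<B>0(3) by meson
    have "compact ((+) x ` K0)" "B \<subseteq> (+) x ` K0" using UK(2,4) B(3) compact_translate by blast+
    then show ?thesis using B by (auto simp: \<B>_def)
  qed
  \<comment> \<open>Finite unions are taken so that every open set is an increasing union of
    members.\<close>
  define \<U> where "\<U> = Union ` {F. finite F \<and> F \<subseteq> \<B>}"
  have \<U>c: "countable \<U>" unfolding \<U>_def using countable_Collect_finite_subset[OF \<B>(1)] by (rule countable_image)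
  have \<U>o: "open V" if "V \<in> \<U>" for V using that \<B>(2) by (auto simp: \<U>_def)
  have \<U>k: "\<exists>K. compact K \<and> V \<subseteq> K" if V: "V \<in> \<U>" for V
  proof -
    obtain F where F: "finite F" "F \<subseteq> \<B>" "V = \<Union>F" using V by (auto simp: \<U>_def)
    have "\<forall>B\<in>F. \<exists>K. compact K \<and> B \<subseteq> K" using F(2) \<B>(3) by blast
    from bchoice[OF this] obtain k where k: "\<forall>B\<in>F. compact (k B) \<and> B \<subseteq> k B" ..
    have "compact (\<Union>B\<in>F. k B)" using F(1) k by (intro compact_UN) auto
    moreover have "V \<subseteq> (\<Union>B\<in>F. k B)" using k F(3) by blast
    ultimately show ?thesis by blast
  qed
  have \<U>L: "indicator V \<in> L" if "V \<in> \<U>" for V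
    using \<U>k[OF that] indicator_in_L[OF open_sets[OF \<U>o[OF that]]] by blast
  have exhaust: "\<exists>E. (\<forall>n. E n \<in> \<U>) \<and> incseq E \<and> (\<Union>n. E n) = U" if U: "open U" for U
  proof -
    define S where "S = {B \<in> \<B>. B \<subseteq> U}"
    have S: "S \<noteq> {}" "S \<subseteq> \<B>" by (auto simp: S_def \<B>_def)
    have "countable S" using S(2) \<B>(1) by (rule countable_subset)
    have S_Un: "\<Union>S = U" using base[OF U] by (auto simp: S_def)
    define E where "E n = \<Union>(from_nat_into S ` {..<n})" for n
    have "E n \<in> \<U>" for n
      unfolding E_def \<U>_def using from_nat_into[OF S(1)] S(2) by blast
    moreover have "incseq E" unfolding E_def incseq_def by (auto intro: less_le_trans)
    moreover have "(\<Union>n. E n) = U"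
    proof -
      have "(\<Union>n. E n) = \<Union>(range (from_nat_into S))" unfolding E_def by (auto intro: lessI)
      then show ?thesis using range_from_nat_into[OF S(1) \<open>countable S\<close>] S_Un by simp
    qed
    ultimately show ?thesis by blast
  qed
  obtain Q :: "complex set" where Q: "countable Q" "\<forall>X. open X \<longrightarrow> X \<noteq> {} \<longrightarrow> (\<exists>d\<in>Q. d \<in> X)"
    using countable_dense_exists by (elim exE conjE)
  \<comment> \<open>Lists encode the combinations: lists over a countable set are countable, and
    appending lists adds the functions.\<close>
  define g :: "(complex \<times> 'a set) list \<Rightarrow> 'a \<Rightarrow> complex" where
    "g xs = (\<lambda>t. \<Sum>(q, V)\<leftarrow>xs. q * indicator V t)" for xs
  define D where "D = g ` lists (Q \<times> \<U>)"
  have "countable D" unfolding D_def using Q(1) \<U>c by auto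
  have DL: "D \<subseteq> L"
  proof -
    have "g xs \<in> L" if "xs \<in> lists (Q \<times> \<U>)" for xs
      using that
    proof (induction xs)
      case Nil
      then show ?case using L_scale[OF indicator_in_L[of "{}" "{}"], of 0] by (simp add: g_def)
    next
      case (Cons z xs)
      obtain q V where z: "z = (q, V)" "V \<in> \<U>" using Cons by auto
      show ?case using minkowski(1)[OF L_scale[OF \<U>L[OF z(2)], of q] Cons.IH] z by (simp add: g_def)
    qed
    then show ?thesis by (auto simp: D_def)
  qed
  have D_add: "(\<lambda>t. c t + d t) \<in> D" if cd: "c \<in> D" "d \<in> D" for c d
  proof -
    obtain xs ys where "xs \<in> lists (Q \<times> \<U>)" "ys \<in> lists (Q \<times> \<U>)" "c = g xs" "d = g ys"
      using cd by (auto simp: D_def)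
    then show ?thesis unfolding D_def by (intro image_eqI[of _ _ "xs @ ys"]) (auto simp: g_def)
  qed
  have zero: "approximable D (\<lambda>_. 0)"
  proof -
    have "(\<lambda>_. 0) \<in> D" unfolding D_def by (intro image_eqI[of _ _ "[]"]) (auto simp: g_def)
    moreover have "N (\<lambda>_. 0) = 0" using N_eq_0[of "\<lambda>_. 0"] calculation DL by auto
    ultimately show ?thesis unfolding approximable_def using DL by (auto intro!: bexI[of _ "\<lambda>_. 0"])
  qed
  have ind_U: "approximable D (\<lambda>t. c * indicator V t)" if V: "V \<in> \<U>" for c V
    unfolding approximable_def
  proof (intro conjI allI impI)
    show "(\<lambda>t. c * indicator V t) \<in> L" by (rule L_scale[OF \<U>L[OF V]])
    fix e :: real assume e: "0 < e"
    \<comment> \<open>The added 1 keeps the denominator positive when \<open>indicator V\<close> has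
      norm 0.\<close>
    define r where "r = e / (N (indicator V) + 1)"
    have pos: "0 < N (indicator V) + 1" using N_nonneg[of "indicator V"] by linarith
    then have "0 < r" using e by (simp add: r_def)
    then have "ball c r \<noteq> {}" by simp
    from Q(2)[rule_format, OF open_ball this] obtain q where q: "q \<in> Q" "q \<in> ball c r" ..
    have "(\<lambda>t. q * indicator V t) \<in> D"
      unfolding D_def using q V by (intro image_eqI[of _ _ "[(q, V)]"]) (auto simp: g_def)
    moreover have "N (\<lambda>t. c * indicator V t - q * indicator V t) < e"
    proof -
      have "N (\<lambda>t. (c - q) * indicator V t) = cmod (c - q) * N (indicator V)" by (rule N_scale[OF \<U>L[OF V]])
      also have "\<dots> \<le> r * N (indicator V)" using q by (intro mult_right_mono) (auto simp: dist_norm)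
      also have "\<dots> < r * (N (indicator V) + 1)" using \<open>0 < r\<close> by simp
      also have "\<dots> = e" using pos by (simp add: r_def)
      finally show ?thesis by (simp add: left_diff_distrib)
    qed
    ultimately show "\<exists>d\<in>D. N (\<lambda>t. c * indicator V t - d t) < e"
      by (intro bexI[of _ "\<lambda>t. q * indicator V t"])
  qed
  have limit: "approximable D (\<lambda>t. c * indicator A t)"
    if E: "\<And>n. approximable D (\<lambda>t. c * indicator (E n) t)" and V: "indicator V \<in> L" "\<And>n. E n \<subseteq> V"
      and A: "A \<in> sets M" and lim: "AE t in M. (\<lambda>n. indicator (E n) t :: complex) \<longlonglongrightarrow> indicator A t"
    for c A V and E :: "nat \<Rightarrow> 'a set"
  proof (rule approximable_dominated[OF DL E L_scale[OF V(1), of c]])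
    show "(\<lambda>t. c * indicator A t) \<in> borel_measurable M" using A by measurable
    show "AE t in M. cmod (c * indicator (E n) t) \<le> cmod (c * indicator V t)" for n
      using V(2)[of n] by (intro AE_I2) (auto simp: indicator_def)
    show "AE t in M. (\<lambda>n. c * indicator (E n) t) \<longlonglongrightarrow> c * indicator A t"
      using lim by eventually_elim (intro tendsto_intros)
  qed
  have ind_open: "approximable D (\<lambda>t. c * indicator A t)" if V: "V \<in> \<U>" and A: "open A" "A \<subseteq> V" for c A V
  proof -
    obtain E where E: "\<forall>n. E n \<in> \<U>" "incseq E" "(\<Union>n. E n) = A" using exhaust[OF A(1)] by blast
    show ?thesis
    proof (rule limit[OF ind_U \<U>L[OF V] _ open_sets[OF A(1)]])
      show "E n \<in> \<U>" for n using E(1) by blast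
      show "E n \<subseteq> V" for n using E(3) A(2) by blast
      show "AE t in M. (\<lambda>n. indicator (E n) t :: complex) \<longlonglongrightarrow> indicator A t"
        using LIMSEQ_indicator_incseq[OF E(2)] unfolding E(3) by (intro AE_I2)
    qed
  qed
  have ind_borel: "approximable D (\<lambda>t. c * indicator A t)" if V: "V \<in> \<U>" and A: "A \<in> sets M" "A \<subseteq> V" for c A V
  proof -
    obtain K where K: "compact K" "V \<subseteq> K" using \<U>k[OF V] by blast
    have Afm: "A \<in> fmeasurable M"
      by (rule fmeasurableI2[OF compact_fmeasurable[OF K(1)] _ A(1)]) (use A(2) K(2) in blast)
    have "\<forall>n. \<exists>W. open W \<and> A \<subseteq> W \<and> W \<in> fmeasurable M \<and> measure M (W - A) < 1 / real (Suc n)"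
    proof
      fix n
      show "\<exists>W. open W \<and> A \<subseteq> W \<and> W \<in> fmeasurable M \<and> measure M (W - A) < 1 / real (Suc n)"
        by (rule outer_regular[OF Afm, of "1 / real (Suc n)"]) auto
    qed
    from choice[OF this] obtain W where W: "\<forall>n. open (W n) \<and> A \<subseteq> W n \<and> W n \<in> fmeasurable M \<and> measure M (W n - A) < 1 / real (Suc n)" ..
    \<comment> \<open>Intersecting with \<open>V\<close> keeps a majorant in \<open>L\<close>;
      accumulating the \<open>W i\<close> makes the sequence decreasing, so that its indicators
      converge pointwise to that of the intersection.\<close>
    define P where "P n = V \<inter> (\<Inter>i\<le>n. W i)" for n
    have P: "open (P n)" "P n \<subseteq> V" for n
      using W \<U>o[OF V] by (auto simp: P_def intro!: open_Int open_INT)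
    have "decseq P" by (auto simp: P_def decseq_def)
    have Pm: "(\<Inter>n. P n) \<in> sets M" using P(1) by (intro sets.countable_INT) (auto intro: open_sets)
    \<comment> \<open>The intersection lies in every \<open>W n\<close>, so its excess over
      \<open>A\<close> is smaller than every \<open>1 / Suc n\<close>.\<close>
    have "(\<Inter>n. P n) - A \<in> null_sets M"
    proof -
      have fm: "(\<Inter>n. P n) - A \<in> fmeasurable M"
        by (rule fmeasurableI2[OF compact_fmeasurable[OF K(1)]]) (use P(2) K(2) Pm A(1) in blast)+
      have "measure M ((\<Inter>n. P n) - A) < e" if e: "0 < e" for e
      proof -
        obtain n where n: "1 / real (Suc n) < e" using nat_approx_posE[OF e] .
        have "measure M ((\<Inter>n. P n) - A) \<le> measure M (W n - A)"
          using W fm A(1) by (intro measure_mono_fmeasurable fmeasurable_Diff fmeasurableD[OF fm]) (auto simp: P_def)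
        also have "\<dots> < 1 / real (Suc n)" using W by blast
        finally show ?thesis using n by simp
      qed
      then have "measure M ((\<Inter>n. P n) - A) = 0" by (metis measure_nonneg less_irrefl less_eq_real_def)
      then show ?thesis using fm by (simp add: null_sets_def emeasure_eq_measure2 fmeasurableD)
    qed
    then have ae: "AE t in M. t \<notin> (\<Inter>n. P n) - A" by (rule AE_not_in)
    have sub: "A \<subseteq> (\<Inter>n. P n)" using W A(2) by (auto simp: P_def)
    show ?thesis
    proof (rule limit[OF ind_open[OF V P] \<U>L[OF V] P(2) A(1)])
      show "AE t in M. (\<lambda>n. indicator (P n) t :: complex) \<longlonglongrightarrow> indicator A t"
        using ae
      proof eventually_elim
        case (elim t)
        then have "indicator A t = (indicator (\<Inter>n. P n) t :: complex)" using sub by (auto simp: indicator_def)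
        then show ?case using LIMSEQ_indicator_decseq[OF \<open>decseq P\<close>, of t] by simp
      qed
    qed
  qed
  have ind: "approximable D (\<lambda>t. c * indicator A t)" if A: "A \<in> sets M" "indicator A \<in> L" for A c
  proof -
    obtain E where E: "\<forall>n. E n \<in> \<U>" "incseq E" "(\<Union>n. E n) = UNIV" using exhaust[OF open_UNIV] by blast
    have Em: "E n \<in> sets M" for n using E(1) \<U>o by (intro open_sets) blast
    \<comment> \<open>Here \<open>A\<close> need not lie in a member of \<open>\<U>\<close>; it is
      exhausted by the sets \<open>A \<inter> E n\<close>, with its own indicator as
      majorant.\<close>
    show ?thesis
    proof (rule limit[OF ind_borel A(2) _ A(1)])
      show "E n \<in> \<U>" "A \<inter> E n \<in> sets M" "A \<inter> E n \<subseteq> E n" "A \<inter> E n \<subseteq> A" for n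
        using E(1) A(1) Em by auto
      have "incseq (\<lambda>n. A \<inter> E n)" using E(2) by (auto simp: incseq_def)
      from LIMSEQ_indicator_incseq[OF this]
      have "(\<lambda>n. indicator (A \<inter> E n) t :: complex) \<longlonglongrightarrow> indicator (\<Union>n. A \<inter> E n) t" for t .
      moreover have "(\<Union>n. A \<inter> E n) = A" using E(3) by blast
      ultimately show "AE t in M. (\<lambda>n. indicator (A \<inter> E n) t :: complex) \<longlonglongrightarrow> indicator A t" by simp
    qed
  qed
  have "approximable D f" if "f \<in> L" for f
    by (rule approximable_all[OF DL D_add zero ind that])
  then show ?thesis
    unfolding separable_iff using DL \<open>countable D\<close> by (auto simp: approximable_def intro!: exI[of _ D])
qed

end

theorem theorem2p3:
  fixes M :: "'a::{topological_group_add, t2_space} measure"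
    and p :: real and \<omega> :: "'a \<Rightarrow> real"
  assumes "locally_compact_space (euclidean :: 'a topology)"
    and "left_haar_measure M"
    and "1 \<le> p"
    and "weight M p \<omega>"
  shows "((\<exists>S f. admissible M S \<omega> \<and> dense_vector M p \<omega> S f)
            \<longrightarrow> second_countable (euclidean :: 'a topology))
       \<and> (second_countable (euclidean :: 'a topology)
            \<longleftrightarrow> separable_space (Lp_topology M p \<omega>))"
proof -
  interpret weighted_haar_group M p \<omega>
    by unfold_locales (use assms in \<open>auto simp: weight_def\<close>)
  have "second_countable (euclidean :: 'a topology)" if dv: "dense_vector M p \<omega> S f" for S f
  proof -
    \<comment> \<open>The translates are collected as functions; \<open>closure_of_classes\<close>
      then restricts the approximants to those in \<open>L\<close>.\<close>
    define D where "D = {\<lambda>t. c * translate s f t | c s. s \<in> S}"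
    have "{Lp_class M p \<omega> (\<lambda>t. c * translate s f t) | c s. s \<in> S} = Lp_class M p \<omega> ` D"
      unfolding D_def by blast
    then have f: "f \<in> L" and "Lp_topology M p \<omega> closure_of (Lp_class M p \<omega> ` D) = Lp_space M p \<omega>"
      using dv unfolding dense_vector_def by simp_all
    then have D: "\<forall>g\<in>L. \<forall>e>0. \<exists>d\<in>D \<inter> L. N (\<lambda>t. g t - d t) < e"
      unfolding closure_of_classes by simp
    show ?thesis
    proof (rule dense_translates_imp_second_countable[OF f])
      fix g and e :: real assume "g \<in> L" "0 < e"
      then obtain d where "d \<in> D" "d \<in> L" "N (\<lambda>t. g t - d t) < e" using D by blast
      then show "\<exists>c s. (\<lambda>t. c * translate s f t) \<in> L \<and> N (\<lambda>t. g t - c * translate s f t) < e"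
        unfolding D_def by blast
    qed
  qed
  then show ?thesis
    using separable_imp_second_countable second_countable_imp_separable by blast
qed

end
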